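(* Let $\Gamma$ be an infinite, connected, and locally finite graph. Then $\Gamma$ admits a transitive translation-like action by $\mathbb{Z}$ if and only if $\Gamma$ has either one or two ends. Moreover, in this case the transitive translation-like action $\ast$ can be taken with $d_\Gamma(v,v\ast 1)\leq 3$ for every vertex $v$ of $\Gamma$.
   Context: Graphs are undirected; loops and multiple edges are allowed. A graph is finite when its edge set is finite, and locally finite when every vertex has finite degree. For a connected graph $\Gamma$, $d_\Gamma$ is the path-length metric on the vertex set $V(\Gamma)$. The number of ends of $\Gamma$ is the supremum, over all finite sets $V\subset V(\Gamma)$, of the number of infinite connected components of the graph $\Gamma-V$ obtained by removing the vertices in $V$ and all edges incident to them. A right action $\ast$ of a group $H$ on a metric space $(X,d)$ is translation-like if it is free (that is, $x\ast h=x$ implies $h=1_H$, for $x\in X$, $h\in H$) and for each $h\in H$ the set $\{d(x,x\ast h)\mid x\in X\}\subset\mathbb{R}$ is bounded. A translation-like action on a connected graph $\Gamma$ is a translation-like action on $(V(\Gamma),d_\Gamma)$. It is transitive if it has only one orbit. *)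

theory Defs
  imports
    "HOL-Library.Uprod"
    "HOL-Library.Extended_Nat"
    "HOL-Algebra.Elementary_Groups"
    "HOL-Analysis.Abstract_Metric_Spaces"
begin

section \<open>Undirected multigraphs\<close>

text \<open>
  Loops are edges with endpoints \<open>Upair v v\<close>; multiple edges are distinct edges with the
  same endpoints.
\<close>

record ('v, 'e) multigraph =
  verts :: "'v set"
  edges :: "'e set"
  endpoints :: "'e \<Rightarrow> 'v uprod"

definition wf_multigraph :: "('v, 'e) multigraph \<Rightarrow> bool" where
  "wf_multigraph G \<longleftrightarrow> (\<forall>e\<in>edges G. set_uprod (endpoints G e) \<subseteq> verts G)"

text \<open>Finiteness refers to the edge set, not to the vertex set.\<close>

definition finite_multigraph :: "('v, 'e) multigraph \<Rightarrow> bool" where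
  "finite_multigraph G \<longleftrightarrow> finite (edges G)"

text \<open>
  Whether a loop counts once or twice towards the degree is irrelevant for the degree being finite.
\<close>

definition locally_finite_multigraph :: "('v, 'e) multigraph \<Rightarrow> bool" where
  "locally_finite_multigraph G \<longleftrightarrow>
     (\<forall>v\<in>verts G. finite {e \<in> edges G. v \<in> set_uprod (endpoints G e)})"

fun walk :: "('v, 'e) multigraph \<Rightarrow> 'v \<Rightarrow> 'e list \<Rightarrow> 'v \<Rightarrow> bool" where
  "walk G u [] v \<longleftrightarrow> u \<in> verts G \<and> u = v"
| "walk G u (e # es) v \<longleftrightarrow>
     e \<in> edges G \<and> (\<exists>w. endpoints G e = Upair u w \<and> walk G w es v)"

definition connected_multigraph :: "('v, 'e) multigraph \<Rightarrow> bool" where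
  "connected_multigraph G \<longleftrightarrow>
     verts G \<noteq> {} \<and> (\<forall>u\<in>verts G. \<forall>v\<in>verts G. \<exists>es. walk G u es v)"

text \<open>
  The value is only meaningful if \<open>u\<close> and \<open>v\<close> are joined by a walk; otherwise it is
  \<open>Inf {} = 0\<close>.
\<close>

definition path_dist :: "('v, 'e) multigraph \<Rightarrow> 'v \<Rightarrow> 'v \<Rightarrow> real" where
  "path_dist G u v = real (Inf {length es | es. walk G u es v})"


section \<open>Connected components and the number of ends\<close>

definition delete_verts :: "('v, 'e) multigraph \<Rightarrow> 'v set \<Rightarrow> ('v, 'e) multigraph" where
  "delete_verts G V =
     \<lparr>verts = verts G - V,
      edges = {e \<in> edges G. set_uprod (endpoints G e) \<inter> V = {}},
      endpoints = endpoints G\<rparr>"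

definition component_of :: "('v, 'e) multigraph \<Rightarrow> 'v \<Rightarrow> ('v, 'e) multigraph" where
  "component_of G v =
     (let W = {w. \<exists>es. walk G v es w} in
        \<lparr>verts = W,
         edges = {e \<in> edges G. set_uprod (endpoints G e) \<subseteq> W},
         endpoints = endpoints G\<rparr>)"

definition components_multigraph :: "('v, 'e) multigraph \<Rightarrow> ('v, 'e) multigraph set" where
  "components_multigraph G = component_of G ` verts G"

definition ecard :: "'a set \<Rightarrow> enat" where
  "ecard A = (if finite A then enat (card A) else \<infinity>)"

definition num_ends :: "('v, 'e) multigraph \<Rightarrow> enat" where
  "num_ends G =
     (SUP V \<in> {V. finite V \<and> V \<subseteq> verts G}.
        ecard {C \<in> components_multigraph (delete_verts G V). \<not> finite_multigraph C})"


section \<open>Translation-like actions\<close>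

locale right_action = group H for H (structure) +
  fixes X :: "'x set" and act :: "'x \<Rightarrow> 'h \<Rightarrow> 'x"
  assumes act_closed: "\<lbrakk>x \<in> X; h \<in> carrier H\<rbrakk> \<Longrightarrow> act x h \<in> X"
    and act_one: "x \<in> X \<Longrightarrow> act x \<one> = x"
    and act_mult: "\<lbrakk>x \<in> X; g \<in> carrier H; h \<in> carrier H\<rbrakk> \<Longrightarrow> act x (g \<otimes> h) = act (act x g) h"

locale translation_like_action = right_action H X act + Metric_space X d
  for H (structure) and X :: "'x set" and d :: "'x \<Rightarrow> 'x \<Rightarrow> real" and act :: "'x \<Rightarrow> 'h \<Rightarrow> 'x" +
  assumes free: "\<lbrakk>x \<in> X; h \<in> carrier H; act x h = x\<rbrakk> \<Longrightarrow> h = \<one>"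
    and bounded_displacement: "h \<in> carrier H \<Longrightarrow> bounded {d x (act x h) | x. x \<in> X}"

definition transitive_action ::
    "('h, 'm) monoid_scheme \<Rightarrow> 'x set \<Rightarrow> ('x \<Rightarrow> 'h \<Rightarrow> 'x) \<Rightarrow> bool" where
  "transitive_action H X act \<longleftrightarrow> is_singleton ((\<lambda>x. act x ` carrier H) ` X)"

definition transitive_translation_like_on_graph ::
    "('h, 'm) monoid_scheme \<Rightarrow> ('v, 'e) multigraph \<Rightarrow> ('v \<Rightarrow> 'h \<Rightarrow> 'v) \<Rightarrow> bool" where
  "transitive_translation_like_on_graph H G act \<longleftrightarrow>
     translation_like_action H (verts G) (path_dist G) act \<and> transitive_action H (verts G) act"


section \<open>The path-length metric is a metric\<close>

lemma walk_append:
  "walk G u es v \<Longrightarrow> walk G v fs w \<Longrightarrow> walk G u (es @ fs) w"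
  by (induction es arbitrary: u) auto

lemma walk_rev:
  assumes "wf_multigraph G"
  shows "walk G u es v \<Longrightarrow> walk G v (rev es) u"
proof (induction es arbitrary: u)
  case Nil
  then show ?case by auto
next
  case (Cons e es)
  then obtain w where w: "e \<in> edges G" "endpoints G e = Upair u w" "walk G w es v"
    by auto
  have "u \<in> verts G"
    using assms w(1,2) by (force simp: wf_multigraph_def)
  then have "walk G w [e] u"
    using w(1,2) by auto
  then show ?case
    using Cons.IH[OF w(3)] walk_append by fastforce
qed

lemma path_dist_le: "walk G u es v \<Longrightarrow> path_dist G u v \<le> real (length es)"
  unfolding path_dist_def by (auto intro: cInf_lower)

lemma path_dist_attained:
  assumes "walk G u es v"
  obtains fs where "walk G u fs v" "path_dist G u v = real (length fs)"
proof -
  have "Inf {length es | es. walk G u es v} \<in> {length es | es. walk G u es v}"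
    by (rule Inf_nat_def1) (use assms in blast)
  with that show thesis
    by (auto simp: path_dist_def)
qed

lemma Metric_space_path_dist:
  assumes wf: "wf_multigraph G" and conn: "connected_multigraph G"
  shows "Metric_space (verts G) (path_dist G)"
proof
  fix x y
  show "0 \<le> path_dist G x y"
    by (simp add: path_dist_def)
  have "{length es | es. walk G x es y} = {length es | es. walk G y es x}"
    using walk_rev[OF wf] by (metis (no_types, opaque_lifting) length_rev)
  then show "path_dist G x y = path_dist G y x"
    by (simp add: path_dist_def)
next
  fix x y
  assume xy: "x \<in> verts G" "y \<in> verts G"
  obtain es where "walk G x es y" "path_dist G x y = real (length es)"
    using conn xy path_dist_attained by (metis connected_multigraph_def)
  moreover have "path_dist G x x \<le> 0"
    using path_dist_le[of G x "[]" x] xy by simp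
  then have "path_dist G x x = 0"
    by (simp add: path_dist_def)
  ultimately show "path_dist G x y = 0 \<longleftrightarrow> x = y"
    by auto
next
  fix x y z
  assume xyz: "x \<in> verts G" "y \<in> verts G" "z \<in> verts G"
  obtain es where es: "walk G x es y" "path_dist G x y = real (length es)"
    using conn xyz path_dist_attained by (metis connected_multigraph_def)
  obtain fs where fs: "walk G y fs z" "path_dist G y z = real (length fs)"
    using conn xyz path_dist_attained by (metis connected_multigraph_def)
  show "path_dist G x z \<le> path_dist G x y + path_dist G y z"
    using path_dist_le[OF walk_append[OF es(1) fs(1)]] es(2) fs(2) by simp
qed

end

theory Submission
  imports Defs
begin

text \<open>
  A transitive translation-like action of the integers is a bi-infinite path \<open>f\<close> that visits
  every vertex once and whose jumps \<open>f i\<close>, \<open>f (i + 1)\<close> have bounded length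
  (\<open>line_of_action\<close>, \<open>action_of_line\<close>). So the theorem says that such a path exists exactly when
  the graph has at most two ends, and that jumps of length 3 suffice.

  If the path exists, delete a finite vertex set \<open>F\<close>. All but finitely many jumps start far from
  \<open>F\<close>, so both tails of the path stay in one component each, and an infinite component contains
  some vertex of a tail. Hence there are at most two infinite components
  (\<open>at_most_two_ended_if_line\<close>).

  Conversely, a finite tree has a Hamiltonian path with jumps at most 3 that goes from the root to
  the root or one of its neighbours (\<open>rooted_tree_hamiltonian\<close>). A one-ended graph has a ray
  \<open>r\<^sub>0, r\<^sub>1, \<dots>\<close> together with disjoint finite trees \<open>S\<^sub>i\<close> (the bags) rooted at the \<open>r\<^sub>i\<close>
  that cover all vertices (\<open>one_ended_bagged_ray\<close>): repeatedly remove a finite connected set whose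
  complement is connected, cover it by a path with bags, and continue at a neighbour of the
  last vertex.
  Traversing the bags of even index and those of odd index yields two one-way infinite paths: the
  jump from the end of \<open>S\<^sub>i\<close>, which is within distance 1 of \<open>r\<^sub>i\<close>, to \<open>r\<^bsub>i+2\<^esub>\<close> has length at
  most 3. Joined at the edge from \<open>r\<^sub>0\<close> to \<open>r\<^sub>1\<close> they form the bi-infinite path
  (\<open>line_if_one_ended\<close>).

  A connected graph with two ends splits into two connected one-ended halves
  (\<open>line_if_at_most_two_ended\<close>). Each half is traversed along all of its bags, starting at
  an edge between the halves, and the two one-way paths are joined at this edge
  (\<open>line_if_one_ended_halves\<close>).

  These arguments take place in a symmetric, locally finite adjacency relation. Its infinite
  components after deleting vertices correspond to the components with infinitely many edges of
  the multigraph (\<open>finite_component_iff\<close>), because a locally finite graph has only finitely many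
  edges at a finite vertex set.
\<close>

section \<open>Concatenating finite lists into a sequence\<close>

text \<open>
  The relation \<open>R\<close> governs neighbours in the sequence and \<open>Q\<close> all ordered pairs. With \<open>Q\<close> as
  inequality this glues Hamiltonian paths of bags; with \<open>Q\<close> as disjointness of bags it glues
  finite paths with bags.
\<close>

lemma infinite_concatenation:
  fixes l :: "nat \<Rightarrow> 'a list"
  assumes ne: "\<And>n. l n \<noteq> []"
    and step: "\<And>n. successively R (l n)"
    and join: "\<And>n. R (last (l n)) (hd (l (Suc n)))"
    and within: "\<And>n. sorted_wrt Q (l n)"
    and across: "\<And>m n x y. m < n \<Longrightarrow> x \<in> set (l m) \<Longrightarrow> y \<in> set (l n) \<Longrightarrow> Q x y"
  obtains g :: "nat \<Rightarrow> 'a"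
  where "g 0 = hd (l 0)" "\<And>i. R (g i) (g (Suc i))" "\<And>i j. i < j \<Longrightarrow> Q (g i) (g j)"
    "range g = (\<Union>n. set (l n))"
proof -
  define c where "c n = concat (map l [0..<n])" for n
  have c_Suc: "c (Suc n) = c n @ l n" for n
    by (simp add: c_def)
  have c0: "c 0 = []" by (simp add: c_def)
  have len: "n \<le> length (c n)" for n
  proof (induction n)
    case (Suc n)
    have "length (l n) > 0" using ne by simp
    then show ?case using Suc c_Suc by (simp del: length_greater_0_conv)
  qed simp
  have ext: "\<exists>zs. c n = c m @ zs" if "m \<le> n" for m n
    using that by (induction rule: dec_induct) (auto simp: c_Suc)
  define g where "g k = c (Suc k) ! k" for k
  have g: "g k = c n ! k" if "k < length (c n)" for k n
  proof (cases "n \<le> Suc k")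
    case True
    then show ?thesis using ext[OF True] that by (auto simp: g_def nth_append)
  next
    case False
    then obtain zs where "c n = c (Suc k) @ zs" using ext[of "Suc k" n] by auto
    moreover have "k < length (c (Suc k))" using len[of "Suc k"] by simp
    ultimately show ?thesis by (simp add: g_def nth_append)
  qed
  have setc: "set (c n) = (\<Union>i<n. set (l i))" for n
    by (auto simp: c_def)
  have last_c: "last (c (Suc n)) = last (l n)" for n
    using ne by (simp add: c_Suc)
  have succ: "successively R (c n)" for n
  proof (induction n)
    case (Suc n)
    have "R (last (c n)) (hd (l n))" if "c n \<noteq> []"
      using that last_c join c0 by (cases n) auto
    then show ?case using Suc step by (auto simp: c_Suc successively_append_iff)
  qed (simp add: c0)
  have srt: "sorted_wrt Q (c n)" for n
    by (induction n) (auto simp: c0 c_Suc sorted_wrt_append within setc intro: across)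
  show thesis
  proof
    show "g 0 = hd (l 0)"
      using ne by (simp add: g_def c_Suc c0 hd_conv_nth)
    show "R (g i) (g (Suc i))" for i
    proof -
      have "Suc i < length (c (Suc (Suc i)))" using len[of "Suc (Suc i)"] by simp
      then show ?thesis
        using g[of i "Suc (Suc i)"] g[of "Suc i" "Suc (Suc i)"] succ[of "Suc (Suc i)"]
        by (simp add: successively_conv_nth)
    qed
    show "Q (g i) (g j)" if "i < j" for i j
    proof -
      have "j < length (c (Suc j))" using len[of "Suc j"] by simp
      then show ?thesis
        using that g[of _ "Suc j"] srt[of "Suc j"] by (simp add: sorted_wrt_iff_nth_less)
    qed
    show "range g = (\<Union>n. set (l n))"
    proof
      show "range g \<subseteq> (\<Union>n. set (l n))"
      proof clarify
        fix k
        have "k < length (c (Suc k))" using len[of "Suc k"] by simp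
        then have "g k \<in> set (c (Suc k))" by (simp add: g_def)
        then show "g k \<in> (\<Union>n. set (l n))" by (auto simp: setc)
      qed
      show "(\<Union>n. set (l n)) \<subseteq> range g"
      proof clarify
        fix n x assume "x \<in> set (l n)"
        then have "x \<in> set (c (Suc n))" by (simp add: c_Suc)
        then obtain k where "k < length (c (Suc n))" "x = c (Suc n) ! k"
          by (metis in_set_conv_nth)
        then show "x \<in> range g" using g by (metis rangeI)
      qed
    qed
  qed
qed

section \<open>Distance in a locally finite graph\<close>

locale locally_finite_adjacency =
  fixes E :: "'v \<Rightarrow> 'v \<Rightarrow> bool"
  assumes sym: "E x y \<Longrightarrow> E y x"
    and finite_neighbours: "finite {y. E x y}"
begin

definition near :: "nat \<Rightarrow> 'v \<Rightarrow> 'v \<Rightarrow> bool" where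
  "near n u v \<longleftrightarrow> (\<exists>k\<le>n. (E ^^ k) u v)"

lemma near_refl [simp]: "near n u u"
  unfolding near_def by (rule exI[of _ 0]) simp

lemma near_adj: "E u v \<Longrightarrow> near 1 u v"
  unfolding near_def by (rule exI[of _ 1]) (simp add: eq_OO)

lemma near_le: "near m u v \<Longrightarrow> m \<le> n \<Longrightarrow> near n u v"
  unfolding near_def using order_trans by blast

lemma near_trans: "near m u v \<Longrightarrow> near n v w \<Longrightarrow> near (m + n) u w"
  unfolding near_def
proof clarify
  fix k k' assume "k \<le> m" "k' \<le> n" "(E ^^ k) u v" "(E ^^ k') v w"
  then show "\<exists>j\<le>m + n. (E ^^ j) u w"
    by (intro exI[of _ "k + k'"]) (auto simp: relpowp_add)
qed

lemma near_sym: "near n u v \<Longrightarrow> near n v u"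
proof -
  have "(E ^^ k) u v \<Longrightarrow> (E ^^ k) v u" for k
  proof (induction k arbitrary: v)
    case (Suc k)
    then obtain w where "(E ^^ k) u w" "E w v" by auto
    then show ?case using Suc.IH sym by (meson relpowp_Suc_I2)
  qed auto
  then show "near n u v \<Longrightarrow> near n v u" by (auto simp: near_def)
qed

lemma finite_near: "finite {v. near n u v}"
proof -
  have "finite {v. (E ^^ k) u v}" for k
  proof (induction k)
    case (Suc k)
    have "{v. (E ^^ Suc k) u v} = (\<Union>w\<in>{w. (E ^^ k) u w}. {v. E w v})" by auto
    then show ?case using Suc finite_neighbours by simp
  qed simp
  moreover have "{v. near n u v} = (\<Union>k\<le>n. {v. (E ^^ k) u v})" by (auto simp: near_def)
  ultimately show ?thesis by simp
qed

section \<open>Trees have Hamiltonian paths with jumps at most three\<close>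

text \<open>
  Only the vertex set and the root of a tree are recorded. Grafting a whole subtree at the root,
  rather than a single leaf, gives the recursion in which Hamiltonian paths are built.
\<close>

inductive rooted_tree :: "'v set \<Rightarrow> 'v \<Rightarrow> bool" where
  single: "rooted_tree {r} r"
| graft: "rooted_tree S r \<Longrightarrow> rooted_tree T c \<Longrightarrow> E r c \<Longrightarrow> S \<inter> T = {} \<Longrightarrow> rooted_tree (S \<union> T) r"

lemma rooted_tree_root: "rooted_tree S r \<Longrightarrow> r \<in> S"
  by (induction rule: rooted_tree.induct) auto

lemma rooted_tree_add_leaf:
  "rooted_tree S r \<Longrightarrow> u \<in> S \<Longrightarrow> E u v \<Longrightarrow> v \<notin> S \<Longrightarrow> rooted_tree (insert v S) r"
proof (induction rule: rooted_tree.induct)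
  case (single r)
  then show ?case
    using rooted_tree.graft[OF rooted_tree.single[of r] rooted_tree.single[of v]] by (simp add: insert_commute)
next
  case (graft S r T c)
  show ?case
  proof (cases "u \<in> S")
    case True
    then have "rooted_tree (insert v S) r" using graft by simp
    then show ?thesis
      using rooted_tree.graft[of "insert v S" r T c] graft by simp
  next
    case False
    then have "rooted_tree (insert v T) c" using graft by simp
    then show ?thesis
      using rooted_tree.graft[of S r "insert v T" c] graft by simp
  qed
qed

text \<open>
  Requiring the path to end within distance 1 of the root makes the induction work: after
  the path of \<open>S\<close>, traverse the path of the grafted tree backwards. The jump in the middle passes
  through the root \<open>r\<close> and the child \<open>c\<close> and has length at most \<open>1 + 1 + 1\<close>; the new path ends in \<open>c\<close>.
\<close>

lemma rooted_tree_hamiltonian: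
  "rooted_tree S r \<Longrightarrow> \<exists>xs. xs \<noteq> [] \<and> set xs = S \<and> distinct xs \<and> hd xs = r
     \<and> near 1 r (last xs) \<and> successively (near 3) xs"
proof (induction rule: rooted_tree.induct)
  case (single r)
  show ?case by (rule exI[of _ "[r]"]) simp
next
  case (graft S r T c)
  then obtain xs ys where xs: "xs \<noteq> []" "set xs = S" "distinct xs" "hd xs = r"
      "near 1 r (last xs)" "successively (near 3) xs"
    and ys: "ys \<noteq> []" "set ys = T" "distinct ys" "hd ys = c"
      "near 1 c (last ys)" "successively (near 3) ys"
    by blast
  have "near (1 + 1 + 1) (last xs) (last ys)"
    using near_trans[OF near_trans[OF near_sym[OF xs(5)] near_adj[OF graft(3)]] ys(5)] .
  then have jump: "near 3 (last xs) (hd (rev ys))" using ys(1) by (simp add: hd_rev numeral_3_eq_3)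
  have "successively (near 3) (rev ys)"
    using ys(6) near_sym by (auto intro: successively_mono simp: successively_rev)
  then show ?case
    using xs ys graft jump near_adj
    by (intro exI[of _ "xs @ rev ys"]) (auto simp: successively_append_iff last_rev)
qed

section \<open>Connectedness inside a vertex set\<close>

definition reach :: "'v set \<Rightarrow> 'v \<Rightarrow> 'v \<Rightarrow> bool" where
  "reach Z = (\<lambda>x y. E x y \<and> x \<in> Z \<and> y \<in> Z)\<^sup>*\<^sup>*"

definition conn :: "'v set \<Rightarrow> bool" where
  "conn Z \<longleftrightarrow> (\<forall>u\<in>Z. \<forall>v\<in>Z. reach Z u v)"

lemma reach_refl [simp]: "reach Z u u" by (simp add: reach_def)

lemma reach_edge: "E u v \<Longrightarrow> u \<in> Z \<Longrightarrow> v \<in> Z \<Longrightarrow> reach Z u v"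
  by (auto simp: reach_def)

lemma reach_trans: "reach Z u v \<Longrightarrow> reach Z v w \<Longrightarrow> reach Z u w"
  by (simp add: reach_def)

lemma reach_mono: "Z \<subseteq> Z' \<Longrightarrow> reach Z u v \<Longrightarrow> reach Z' u v"
  unfolding reach_def by (erule rtranclp_mono[THEN predicate2D, rotated]) auto

lemma reach_induct [consumes 1, case_names refl step]:
  assumes "reach Z u v" "P u"
    "\<And>x y. reach Z u x \<Longrightarrow> P x \<Longrightarrow> E x y \<Longrightarrow> x \<in> Z \<Longrightarrow> y \<in> Z \<Longrightarrow> P y"
  shows "P v"
  using assms(1) unfolding reach_def
  by (induction rule: rtranclp_induct) (use assms(2,3) in \<open>auto simp: reach_def\<close>)

lemma reach_sym: "reach Z u v \<Longrightarrow> reach Z v u"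
proof (induction rule: reach_induct)
  case (step x y)
  then show ?case using reach_trans reach_edge sym by metis
qed simp

lemma reach_closed:
  assumes "reach Z u v" "u \<in> Y" "\<And>x y. x \<in> Y \<Longrightarrow> E x y \<Longrightarrow> x \<in> Z \<Longrightarrow> y \<in> Z \<Longrightarrow> y \<in> Y"
  shows "v \<in> Y"
  using assms(1) by (induction rule: reach_induct) (use assms in blast)+

lemma reach_within:
  assumes "reach Z u v"
  shows "u = v \<or> u \<in> Z \<and> v \<in> Z"
  using assms by (induction rule: reach_induct) (auto)

text \<open>
  A path from \<open>u\<close> in \<open>Z\<close> never leaves the component of \<open>u\<close>, so components are connected as graphs
  of their own.
\<close>

lemma reach_conn: "conn {v. reach Z u v}"
proof -
  have "reach {v. reach Z u v} u w" if "reach Z u w" for w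
    using that
  proof (induction rule: reach_induct)
    case (step x y)
    then show ?case
      by (metis mem_Collect_eq reach_edge reach_trans)
  qed simp
  then show ?thesis
    unfolding conn_def by (metis mem_Collect_eq reach_sym reach_trans)
qed

lemma reach_path:
  assumes "reach Z u v" "u \<in> Z"
  obtains rs where "rs \<noteq> []" "hd rs = u" "last rs = v" "distinct rs" "successively E rs" "set rs \<subseteq> Z"
proof -
  from assms(1) have "\<exists>rs. rs \<noteq> [] \<and> hd rs = u \<and> last rs = v \<and> distinct rs \<and> successively E rs \<and> set rs \<subseteq> Z"
  proof (induction rule: reach_induct)
    case refl
    show ?case by (rule exI[of _ "[u]"]) (simp add: assms(2))
  next
    case (step x y)
    then obtain rs where rs: "rs \<noteq> []" "hd rs = u" "last rs = x" "distinct rs" "successively E rs" "set rs \<subseteq> Z"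
      by blast
    show ?case
    proof (cases "y \<in> set rs")
      case True
      then obtain as bs where "rs = as @ y # bs" by (meson split_list)
      then show ?thesis
        using rs by (intro exI[of _ "as @ [y]"]) (auto simp: successively_append_iff hd_append split: if_splits)
    next
      case False
      then show ?thesis
        using rs step by (intro exI[of _ "rs @ [y]"]) (auto simp: successively_append_iff)
    qed
  qed
  with that show thesis by blast
qed

lemma reach_exit:
  assumes "reach X u v" "u \<in> Y" "v \<notin> Y"
  obtains x y where "x \<in> Y" "y \<in> X - Y" "E x y" "x \<in> X"
  using assms(1,3) reach_closed[of X u v Y] assms(2) by blast

section \<open>Covering a finite connected set by a path with bags\<close>

text \<open>
  A path in the graph whose vertices carry disjoint finite trees, each rooted at its vertex. In
  each pair the first entry is the vertex of the path, the second its bag.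
\<close>

definition bagged_path :: "('v \<times> 'v set) list \<Rightarrow> bool" where
  "bagged_path ps \<longleftrightarrow> ps \<noteq> [] \<and> successively (\<lambda>p q. E (fst p) (fst q)) ps
     \<and> sorted_wrt (\<lambda>p q. snd p \<inter> snd q = {}) ps
     \<and> (\<forall>p\<in>set ps. rooted_tree (snd p) (fst p))"

text \<open>
  Choose bags on a fixed path that cover as many vertices as possible. If some vertex of \<open>L\<close> were
  missed, connectedness would give an edge leaving the covered part, and its far end could be
  attached to a bag as a leaf.
\<close>

lemma finite_conn_bagged_path:
  assumes conn: "conn L" and fin: "finite L" and ab: "a \<in> L" "b \<in> L"
  obtains ps where "bagged_path ps" "fst (hd ps) = a" "fst (last ps) = b" "\<Union> (snd ` set ps) = L"
proof -
  obtain rs where rs: "rs \<noteq> []" "hd rs = a" "last rs = b" "distinct rs" "successively E rs" "set rs \<subseteq> L"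
    using reach_path conn ab unfolding conn_def by metis
  define good where "good B \<longleftrightarrow> (\<forall>r\<in>set rs. rooted_tree (B r) r) \<and> disjoint_family_on B (set rs)
    \<and> (\<Union>r\<in>set rs. B r) \<subseteq> L" for B
  \<comment> \<open>Bags without further vertices show that good bags exist.\<close>
  define B0 where "B0 = (\<lambda>r::'v. {r})"
  have good0: "good B0"
    using rs by (auto simp: good_def B0_def disjoint_family_on_def intro: single)
  have bound: "card (\<Union>r\<in>set rs. B r) \<le> card L" if "good B" for B
    using that fin by (auto simp: good_def intro!: card_mono)
  obtain B where B: "good B"
    and max: "\<And>B'. good B' \<Longrightarrow> card (\<Union>r\<in>set rs. B' r) \<le> card (\<Union>r\<in>set rs. B r)"
    using ex_has_greatest_nat[of good B0 "\<lambda>B. card (\<Union>r\<in>set rs. B r)" "Suc (card L)"] good0 bound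
    by (metis less_Suc_eq_le)
  let ?U = "\<Union>r\<in>set rs. B r"
  have "?U = L"
  proof (rule ccontr)
    assume "?U \<noteq> L"
    moreover have "?U \<subseteq> L" using B by (simp add: good_def)
    ultimately obtain w where w: "w \<in> L" "w \<notin> ?U" by blast
    have "a \<in> set rs" using rs by (metis hd_in_set)
    then have a: "a \<in> ?U" using rooted_tree_root B by (auto simp: good_def)
    have "reach L a w" using conn ab w by (simp add: conn_def)
    then obtain u v where uv: "u \<in> ?U" "v \<in> L - ?U" "E u v" using reach_exit a w by metis
    then obtain r where r: "r \<in> set rs" "u \<in> B r" by blast
    let ?B = "B(r := insert v (B r))"
    have "rooted_tree (insert v (B r)) r"
      using rooted_tree_add_leaf[of "B r" r u v] B r uv by (auto simp: good_def)
    then have "\<forall>q\<in>set rs. rooted_tree (?B q) q" using B by (simp add: good_def)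
    moreover have un: "(\<Union>q\<in>set rs. ?B q) = insert v ?U"
      using r by (auto split: if_splits)
    moreover have "disjoint_family_on ?B (set rs)"
      using B uv(2) unfolding good_def disjoint_family_on_def
      by (metis Diff_iff Int_insert_left Int_insert_right UN_I fun_upd_def)
    moreover have "insert v ?U \<subseteq> L" using B uv(2) by (simp add: good_def)
    ultimately have "good ?B" unfolding good_def by metis
    then have "card (insert v ?U) \<le> card ?U" using max[of ?B] un by simp
    moreover have "finite ?U" using B fin by (auto simp: good_def intro: finite_subset)
    ultimately show False using uv by simp
  qed
  moreover have "sorted_wrt (\<lambda>r r'. B r \<inter> B r' = {}) rs"
    using B rs(4) unfolding good_def disjoint_family_on_def sorted_wrt_iff_nth_less
    by (metis nth_eq_iff_index_eq nth_mem order.strict_trans less_irrefl_nat)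
  ultimately show thesis
    using B rs by (intro that[of "map (\<lambda>r. (r, B r)) rs"])
      (auto simp: bagged_path_def good_def successively_map sorted_wrt_map hd_map last_map)
qed

section \<open>Infinite components and ends\<close>

definition infinite_comp :: "'v set \<Rightarrow> 'v \<Rightarrow> bool" where
  "infinite_comp Z u \<longleftrightarrow> infinite {v. reach Z u v}"

definition one_ended :: "'v set \<Rightarrow> bool" where
  "one_ended X \<longleftrightarrow> infinite X \<and> conn X \<and>
     (\<forall>F u v. finite F \<longrightarrow> infinite_comp (X - F) u \<longrightarrow> infinite_comp (X - F) v \<longrightarrow> reach (X - F) u v)"

definition at_most_two_ended :: "'v set \<Rightarrow> bool" where
  "at_most_two_ended X \<longleftrightarrow>
     (\<forall>F u v w. finite F \<longrightarrow> infinite_comp (X - F) u \<longrightarrow> infinite_comp (X - F) v \<longrightarrow> infinite_comp (X - F) w \<longrightarrow>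
        reach (X - F) u v \<or> reach (X - F) u w \<or> reach (X - F) v w)"

lemma reach_class_eq: "reach Z u v \<Longrightarrow> {w. reach Z u w} = {w. reach Z v w}"
  using reach_trans reach_sym by blast

lemma infinite_comp_reach: "reach Z u v \<Longrightarrow> infinite_comp Z u \<Longrightarrow> infinite_comp Z v"
  by (simp add: infinite_comp_def reach_class_eq)

lemma infinite_comp_mem: "infinite_comp Z u \<Longrightarrow> u \<in> Z"
  unfolding infinite_comp_def
proof (rule ccontr)
  assume inf: "infinite {v. reach Z u v}" and "u \<notin> Z"
  then have "{v. reach Z u v} \<subseteq> {u}" using reach_within by blast
  then show False using inf finite_subset by blast
qed

lemma infinite_comp_mono: "Z \<subseteq> Z' \<Longrightarrow> infinite_comp Z u \<Longrightarrow> infinite_comp Z' u"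
  unfolding infinite_comp_def using reach_mono by (metis (mono_tags, lifting) Collect_mono finite_subset)

lemma reach_subset_class:
  assumes "reach Z u v" "{w. reach Z u w} \<subseteq> Y"
  shows "reach Y u v"
  using assms(1)
proof (induction rule: reach_induct)
  case (step x y)
  then have "reach Z u y" using reach_edge reach_trans by metis
  then have "x \<in> Y" "y \<in> Y" using assms(2) step.hyps by auto
  then show ?case using reach_trans[OF \<open>reach Y u x\<close> reach_edge[OF \<open>E x y\<close>]] by simp
qed simp

text \<open>
  The component of \<open>v\<close> in \<open>Z - K\<close> can be left only through \<open>K\<close>. A finite \<open>K\<close> has
  finitely many neighbours, so only finitely many components of \<open>Z - K\<close> can be reached from \<open>K\<close>
  inside \<open>Z\<close>.
\<close>

lemma reach_to_boundary:
  assumes "reach Z v c" "v \<in> Z - K" "c \<in> K"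
  obtains w k where "k \<in> K" "E k w" "w \<in> Z - K" "reach (Z - K) v w" "k \<in> Z"
proof -
  let ?Y = "{w. reach (Z - K) v w}"
  have "c \<notin> ?Y" using reach_within assms by fastforce
  moreover have "v \<in> ?Y" by simp
  ultimately obtain x y where xy: "x \<in> ?Y" "y \<in> Z - ?Y" "E x y" "x \<in> Z"
    using reach_exit[OF assms(1), of ?Y] by metis
  have x: "x \<in> Z - K" using xy(1) assms(2) reach_within by blast
  have "y \<in> K"
  proof (rule ccontr)
    assume "y \<notin> K"
    then have "reach (Z - K) x y" using xy x by (intro reach_edge) auto
    then show False using xy reach_trans by blast
  qed
  then show thesis using that[of y x] xy x sym by blast
qed

definition fringe :: "'v set \<Rightarrow> 'v set" where
  "fringe K = (\<Union>k\<in>K. {w. E k w})"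

lemma finite_fringe: "finite K \<Longrightarrow> finite (fringe K)"
  by (simp add: fringe_def finite_neighbours)

text \<open>
  Deleting the finite set \<open>F\<close> breaks an infinite component into pieces each of which, unless \<open>F\<close>
  misses the component altogether, contains a neighbour of \<open>F\<close>. There are finitely many pieces,
  so one of them is infinite.
\<close>

lemma infinite_comp_remove_finite:
  assumes "infinite_comp Z u" "finite F"
  obtains v where "reach Z u v" "infinite_comp (Z - F) v"
proof -
  let ?C = "{v. reach Z u v}"
  have infC: "infinite ?C" using assms by (simp add: infinite_comp_def)
  show thesis
  proof (cases "?C \<inter> F = {}")
    case True
    have "?C \<subseteq> Z" using infinite_comp_mem[OF assms(1)] reach_within by blast
    then have sub: "?C \<subseteq> Z - F" using True by blast
    have "?C \<subseteq> {v. reach (Z - F) u v}" using reach_subset_class[OF _ sub] by blast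
    then have "infinite_comp (Z - F) u" using infC infinite_super by (auto simp: infinite_comp_def)
    then show thesis using that[of u] by simp
  next
    case False
    then obtain c where c: "c \<in> F" "reach Z u c" by blast
    have "?C - F \<subseteq> (\<Union>w\<in>fringe F. {v. reach (Z - F) w v \<and> reach Z u v})"
    proof
      fix v assume v: "v \<in> ?C - F"
      then have "v \<in> Z - F" using reach_within infinite_comp_mem[OF assms(1)] by fastforce
      moreover have "reach Z v c" using v c reach_sym reach_trans by blast
      ultimately obtain w k where "k \<in> F" "E k w" "reach (Z - F) v w"
        using reach_to_boundary c(1) by metis
      then show "v \<in> (\<Union>w\<in>fringe F. {v. reach (Z - F) w v \<and> reach Z u v})"
        using v reach_sym[of "Z - F" v w] by (auto simp: fringe_def)
    qed
    moreover have "infinite (?C - F)" using infC assms(2) by simp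
    ultimately obtain w where "infinite {v. reach (Z - F) w v \<and> reach Z u v}"
      using finite_fringe[OF assms(2)] by (meson finite_UN_I finite_subset)
    then obtain v where v: "reach (Z - F) w v" "reach Z u v"
      by (metis (mono_tags, lifting) empty_Collect_eq finite.emptyI)
    have "infinite_comp (Z - F) w" unfolding infinite_comp_def
      using \<open>infinite {v. reach (Z - F) w v \<and> reach Z u v}\<close>
      by (rule contrapos_nn) (auto elim: rev_finite_subset)
    then show thesis using that v infinite_comp_reach by blast
  qed
qed

lemma conn_if_reach_common:
  assumes "\<And>v. v \<in> S \<Longrightarrow> reach S v c"
  shows "conn S"
  unfolding conn_def
proof clarify
  fix u v assume "u \<in> S" "v \<in> S"
  then show "reach S u v" using reach_trans[OF assms reach_sym[OF assms]] by simp
qed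

lemma finite_conn_superset:
  assumes "conn X" "finite K" "K \<subseteq> X"
  obtains K' where "finite K'" "conn K'" "K \<subseteq> K'" "K' \<subseteq> X"
proof -
  have "\<exists>K'. finite K' \<and> conn K' \<and> K \<subseteq> K' \<and> K' \<subseteq> X"
    using assms(2,3)
  proof (induction K rule: finite_induct)
    case empty
    show ?case by (rule exI[of _ "{}"]) (simp add: conn_def)
  next
    case (insert x K)
    then obtain K' where K': "finite K'" "conn K'" "K \<subseteq> K'" "K' \<subseteq> X" by auto
    show ?case
    proof (cases "K' = {}")
      case True
      then show ?thesis using K' insert.prems by (intro exI[of _ "{x}"]) (auto simp: conn_def)
    next
      case False
      then obtain c where c: "c \<in> K'" by blast
      then have "reach X c x" using assms(1) K' insert.prems by (auto simp: conn_def)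
      then obtain rs where rs: "rs \<noteq> []" "hd rs = c" "last rs = x" "successively E rs" "set rs \<subseteq> X"
        using reach_path c K' by (metis subsetD)
      have path: "successively E qs \<Longrightarrow> qs \<noteq> [] \<Longrightarrow> v \<in> set qs \<Longrightarrow> reach (set qs) v (hd qs)" for qs v
      proof (induction qs arbitrary: v)
        case (Cons q qs)
        show ?case
        proof (cases "v = q")
          case False
          then have qs: "qs \<noteq> []" "v \<in> set qs" using Cons by auto
          then have "reach (set (q # qs)) v (hd qs)"
            using Cons.IH[of v] Cons.prems reach_mono[of "set qs" "set (q # qs)"]
            by (auto simp: successively_Cons)
          moreover have "reach (set (q # qs)) (hd qs) q"
            using Cons.prems qs by (intro reach_edge) (auto simp: successively_Cons sym)
          ultimately show ?thesis using reach_trans by fastforce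
        qed simp
      qed simp
      have "conn (K' \<union> set rs)"
      proof (rule conn_if_reach_common)
        fix v assume "v \<in> K' \<union> set rs"
        then show "reach (K' \<union> set rs) v c"
          using path[OF rs(4,1)] rs(2) K'(2) c reach_mono[of K' "K' \<union> set rs"]
            reach_mono[of "set rs" "K' \<union> set rs"]
          unfolding conn_def by blast
      qed
      moreover have "x \<in> set rs" using rs by auto
      ultimately show ?thesis
        using K' rs by (intro exI[of _ "K' \<union> set rs"]) auto
    qed
  qed
  then show thesis using that by metis
qed

section \<open>One-ended graphs are covered by a ray with bags\<close>

text \<open>
  Enlarge \<open>K\<close> to a finite connected set \<open>M\<close> and add all finite components of \<open>X - M\<close>. Each of
  these contains a neighbour of \<open>M\<close>, hence there are finitely many and the result \<open>L\<close> is finite and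
  connected. What remains is the only infinite component of \<open>X - M\<close>, which inherits
  one-endedness because \<open>L\<close> is finite.
\<close>

lemma one_ended_remove_finite_conn:
  assumes X: "one_ended X" and K: "finite K" "K \<subseteq> X" "K \<noteq> {}"
  obtains L where "finite L" "conn L" "K \<subseteq> L" "L \<subseteq> X" "one_ended (X - L)"
proof -
  have infX: "infinite X" and cX: "conn X" using X by (auto simp: one_ended_def)
  obtain M where M: "finite M" "conn M" "K \<subseteq> M" "M \<subseteq> X"
    using finite_conn_superset[OF cX K(1,2)] .
  obtain c where c: "c \<in> M" using M K by blast
  define L where "L = M \<union> {v \<in> X. \<not> infinite_comp (X - M) v}"
  have bd: "\<exists>w k. k \<in> M \<and> E k w \<and> w \<in> X - M \<and> reach (X - M) v w" if "v \<in> X - M" for v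
  proof -
    have "reach X v c" using that c cX M by (auto simp: conn_def)
    then show ?thesis using reach_to_boundary[of X v c M] that c by metis
  qed
  have "infinite_comp X c" using infX cX c M unfolding infinite_comp_def conn_def
    by (metis (mono_tags, lifting) infinite_super mem_Collect_eq subsetD subsetI)
  then obtain b where b: "infinite_comp (X - M) b" using infinite_comp_remove_finite M by metis
  have XL: "X - L = {v. reach (X - M) b v}"
  proof
    show "X - L \<subseteq> {v. reach (X - M) b v}"
      using X M b unfolding L_def one_ended_def by auto
    show "{v. reach (X - M) b v} \<subseteq> X - L"
      using infinite_comp_reach b infinite_comp_mem unfolding L_def by fastforce
  qed
  have finL: "finite L"
  proof -
    have "L \<subseteq> M \<union> (\<Union>w\<in>{w \<in> fringe M. \<not> infinite_comp (X - M) w}. {v. reach (X - M) w v})"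
    proof
      fix v assume v: "v \<in> L"
      show "v \<in> M \<union> (\<Union>w\<in>{w \<in> fringe M. \<not> infinite_comp (X - M) w}. {v. reach (X - M) w v})"
      proof (cases "v \<in> M")
        case False
        then have "v \<in> X - M" "\<not> infinite_comp (X - M) v" using v by (auto simp: L_def)
        with bd obtain w k where w: "k \<in> M" "E k w" "reach (X - M) v w" by blast
        then have "\<not> infinite_comp (X - M) w" using infinite_comp_reach reach_sym \<open>\<not> infinite_comp (X - M) v\<close> by blast
        then show ?thesis using w reach_sym by (auto simp: fringe_def)
      qed simp
    qed
    moreover have "finite (M \<union> (\<Union>w\<in>{w \<in> fringe M. \<not> infinite_comp (X - M) w}. {v. reach (X - M) w v}))"
      using M(1) finite_fringe by (auto simp: infinite_comp_def)
    ultimately show ?thesis using finite_subset by blast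
  qed
  have "conn L"
  proof (rule conn_if_reach_common)
    fix v assume v: "v \<in> L"
    have up: "reach M x c \<Longrightarrow> reach L x c" for x using reach_mono[of M L] by (auto simp: L_def)
    show "reach L v c"
    proof (cases "v \<in> M")
      case True
      then show ?thesis using up M(2) c by (auto simp: conn_def)
    next
      case False
      then have vX: "v \<in> X - M" "\<not> infinite_comp (X - M) v" using v by (auto simp: L_def)
      with bd obtain w k where w: "k \<in> M" "E k w" "reach (X - M) v w" "w \<in> X - M" by blast
      have "{z. reach (X - M) v z} \<subseteq> L"
      proof
        fix z assume "z \<in> {z. reach (X - M) v z}"
        then have "\<not> infinite_comp (X - M) z" "z \<in> X"
          using vX infinite_comp_reach reach_sym reach_within by (blast, blast)
        then show "z \<in> L" by (simp add: L_def)
      qed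
      then have "reach L v w" "w \<in> L" using reach_subset_class w(3) by blast+
      moreover have "reach L w k" using w \<open>w \<in> L\<close> sym by (intro reach_edge) (auto simp: L_def)
      moreover have "reach L k c" using up M(2) c w by (auto simp: conn_def)
      ultimately show ?thesis using reach_trans by blast
    qed
  qed
  moreover have "one_ended (X - L)"
    unfolding one_ended_def
  proof (intro conjI allI impI)
    show "infinite (X - L)" using infX finL by simp
    show "conn (X - L)" unfolding XL by (rule reach_conn)
    fix F u v assume F: "finite F" and uv: "infinite_comp (X - L - F) u" "infinite_comp (X - L - F) v"
    have "X - L - F = X - (L \<union> F)" by blast
    then show "reach (X - L - F) u v"
      using X F finL uv unfolding one_ended_def by (metis finite_UnI)
  qed
  ultimately show thesis using that[of L] finL M by (auto simp: L_def)
qed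

text \<open>
  One step in the construction of the ray. The vertex \<open>w\<close> is a parameter in order that a
  suitable sequence of these vertices exhausts \<open>X\<close>.
\<close>

lemma one_ended_remove_bagged_path:
  assumes X: "one_ended X" and a: "a \<in> X"
  obtains ps a' where "bagged_path ps" "fst (hd ps) = a" "E (fst (last ps)) a'"
    "\<Union> (snd ` set ps) \<subseteq> X" "w \<in> X \<Longrightarrow> w \<in> \<Union> (snd ` set ps)"
    "one_ended (X - \<Union> (snd ` set ps))" "a' \<in> X - \<Union> (snd ` set ps)"
proof -
  have cX: "conn X" using X by (simp add: one_ended_def)
  obtain L where L: "finite L" "conn L" "{a} \<union> ({w} \<inter> X) \<subseteq> L" "L \<subseteq> X" "one_ended (X - L)"
    using one_ended_remove_finite_conn[OF X, of "{a} \<union> ({w} \<inter> X)"] a by blast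
  have "infinite (X - L)" using L by (simp add: one_ended_def)
  then obtain z where "z \<in> X - L" by (metis ex_in_conv finite.emptyI)
  then have "reach X a z" "a \<in> L" "z \<notin> L" using cX a L by (auto simp: conn_def)
  then obtain b a' where b: "b \<in> L" "a' \<in> X - L" "E b a'" using reach_exit by metis
  obtain ps where "bagged_path ps" "fst (hd ps) = a" "fst (last ps) = b" "\<Union> (snd ` set ps) = L"
    using finite_conn_bagged_path[OF L(2,1), of a b] L b by blast
  then show thesis using that[of ps a'] L b by auto
qed

lemma one_ended_bagged_ray:
  assumes X: "one_ended X" and a: "a \<in> X"
  obtains r :: "nat \<Rightarrow> 'v" and S :: "nat \<Rightarrow> 'v set"
  where "r 0 = a" "\<And>i. E (r i) (r (Suc i))" "\<And>i. rooted_tree (S i) (r i)"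
    "\<And>i j. i \<noteq> j \<Longrightarrow> S i \<inter> S j = {}" "(\<Union>i. S i) = X"
proof -
  have "countable X"
  proof -
    have "X \<subseteq> (\<Union>n. {v. near n a v})"
    proof
      fix v assume "v \<in> X"
      then have "reach X a v" using X a by (simp add: one_ended_def conn_def)
      then show "v \<in> (\<Union>n. {v. near n a v})"
      proof (induction rule: reach_induct)
        case refl
        show ?case using near_refl by blast
      next
        case (step x y)
        then obtain n where "near n a x" by blast
        then have "near (n + 1) a y" using near_trans near_adj[OF \<open>E x y\<close>] by metis
        then show ?case by blast
      qed
    qed
    then show ?thesis
      by (rule countable_subset) (auto intro: countable_finite finite_near)
  qed
  moreover define w where "w = from_nat_into X"
  ultimately have w: "range w = X"
    using a by (auto intro!: range_from_nat_into)
  \<comment> \<open>A state consists of the uncovered rest of \<open>X\<close> and the vertex where the ray continues; stage \<open>n\<close> takes care that \<open>w n\<close> is covered.\<close>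
  define next_step where "next_step n s s' ps \<longleftrightarrow> bagged_path ps \<and> fst (hd ps) = snd s \<and> E (fst (last ps)) (snd s')
      \<and> \<Union> (snd ` set ps) \<subseteq> fst s \<and> (w n \<in> fst s \<longrightarrow> w n \<in> \<Union> (snd ` set ps))
      \<and> fst s' = fst s - \<Union> (snd ` set ps)"
    for n :: nat and s s' :: "'v set \<times> 'v" and ps
  define ok where "ok s \<longleftrightarrow> one_ended (fst s) \<and> snd s \<in> fst s" for s :: "'v set \<times> 'v"
  have "\<exists>s. s 0 = (X, a) \<and> (\<forall>n. ok (s n)) \<and> (\<forall>n. \<exists>ps. next_step n (s n) (s (Suc n)) ps)"
  proof -
    have "\<exists>s. \<forall>n. (ok (s n) \<and> (n = (0::nat) \<longrightarrow> s n = (X, a))) \<and> (\<exists>ps. next_step n (s n) (s (Suc n)) ps)"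
    proof (rule dependent_nat_choice)
      show "\<exists>s. ok s \<and> (0 = (0::nat) \<longrightarrow> s = (X, a))" using X a by (auto simp: ok_def)
    next
      fix s :: "'v set \<times> 'v" and n :: nat assume s: "ok s \<and> (n = 0 \<longrightarrow> s = (X, a))"
      obtain ps a' where "bagged_path ps" "fst (hd ps) = snd s" "E (fst (last ps)) a'"
        "\<Union> (snd ` set ps) \<subseteq> fst s" "w n \<in> fst s \<Longrightarrow> w n \<in> \<Union> (snd ` set ps)"
        "one_ended (fst s - \<Union> (snd ` set ps))" "a' \<in> fst s - \<Union> (snd ` set ps)"
        using one_ended_remove_bagged_path[of "fst s" "snd s" "w n"] s unfolding ok_def by blast
      then show "\<exists>s'. (ok s' \<and> (Suc n = 0 \<longrightarrow> s' = (X, a))) \<and> (\<exists>ps. next_step n s s' ps)"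
        by (intro exI[of _ "(fst s - \<Union> (snd ` set ps), a')"] conjI exI[of _ ps])
          (simp_all add: ok_def next_step_def)
    qed
    then show ?thesis by blast
  qed
  then obtain s where s0: "s 0 = (X, a)" and ok: "\<And>n. ok (s n)"
    and ex: "\<And>n. \<exists>ps. next_step n (s n) (s (Suc n)) ps" by blast
  obtain l where l: "\<And>n. next_step n (s n) (s (Suc n)) (l n)" using ex by metis
  define bag where "bag n = \<Union> (snd ` set (l n))" for n
  have rem: "fst (s (Suc n)) = fst (s n) - bag n" "bag n \<subseteq> fst (s n)" for n
    using l by (simp_all add: next_step_def bag_def)
  have dec: "fst (s n) \<subseteq> fst (s m)" if "m \<le> n" for m n
    using that by (induction rule: dec_induct) (auto simp: rem)
  have bag_disj: "bag m \<inter> bag n = {}" if "m < n" for m n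
    using dec[of "Suc m" n] rem[of m] rem(2)[of n] that by auto
  have cover: "(\<Union>n. bag n) = X"
  proof
    show "(\<Union>n. bag n) \<subseteq> X" using rem(2) dec[of 0] s0 by fastforce
    show "X \<subseteq> (\<Union>n. bag n)"
    proof
      fix x assume x: "x \<in> X"
      then obtain n where n: "x = w n" using w by blast
      show "x \<in> (\<Union>n. bag n)"
      proof (rule ccontr)
        assume nb: "x \<notin> (\<Union>n. bag n)"
        have "x \<in> fst (s k)" for k by (induction k) (use x s0 rem nb in auto)
        then show False using l[of n] n nb by (auto simp: next_step_def bag_def)
      qed
    qed
  qed
  have lp: "bagged_path (l n)" "fst (hd (l n)) = snd (s n)" "E (fst (last (l n))) (snd (s (Suc n)))" for n
    using l by (simp_all add: next_step_def)
  have mem: "snd p \<subseteq> bag n" if "p \<in> set (l n)" for p n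
    using that by (auto simp: bag_def)
  obtain g :: "nat \<Rightarrow> 'v \<times> 'v set" where g: "g 0 = hd (l 0)"
    "\<And>i. E (fst (g i)) (fst (g (Suc i)))" "\<And>i j. i < j \<Longrightarrow> snd (g i) \<inter> snd (g j) = {}"
    "range g = (\<Union>n. set (l n))"
  proof (rule infinite_concatenation[of l "\<lambda>p q. E (fst p) (fst q)" "\<lambda>p q. snd p \<inter> snd q = {}"])
    show "l n \<noteq> []" "successively (\<lambda>p q. E (fst p) (fst q)) (l n)"
      "sorted_wrt (\<lambda>p q. snd p \<inter> snd q = {}) (l n)" for n
      using lp(1)[of n] by (simp_all add: bagged_path_def)
    show "E (fst (last (l n))) (fst (hd (l (Suc n))))" for n using lp(2,3) by simp
    show "snd p \<inter> snd q = {}" if "m < n" "p \<in> set (l m)" "q \<in> set (l n)" for m n p q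
      using bag_disj[OF that(1)] mem that by blast
  qed blast
  show thesis
  proof (rule that[of "\<lambda>i. fst (g i)" "\<lambda>i. snd (g i)"])
    show "fst (g 0) = a" using g(1) lp(2)[of 0] s0 by simp
    show "E (fst (g i)) (fst (g (Suc i)))" for i by (rule g(2))
    show "rooted_tree (snd (g i)) (fst (g i))" for i
    proof -
      have "g i \<in> (\<Union>n. set (l n))" using g(4) by blast
      then show ?thesis using lp(1) by (auto simp: bagged_path_def)
    qed
    show "snd (g i) \<inter> snd (g j) = {}" if "i \<noteq> j" for i j
      using that g(3)[of i j] g(3)[of j i] by (cases "i < j") auto
    have "(\<Union>i. snd (g i)) = (\<Union>p\<in>range g. snd p)" by blast
    also have "\<dots> = (\<Union>n. bag n)" unfolding g(4) bag_def by blast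
    finally show "(\<Union>i. snd (g i)) = X" using cover by simp
  qed
qed

section \<open>Bi-infinite paths with jumps at most three\<close>

text \<open>
  A Hamiltonian path of a bag ends within distance 1 of its root, so roots at distance 2 leave
  jumps of length at most \<open>1 + 2\<close>.
\<close>

lemma ray_from_bags:
  assumes tree: "\<And>i. rooted_tree (S i) (r i)" and disj: "\<And>i j. i \<noteq> j \<Longrightarrow> S i \<inter> S j = {}"
    and close: "\<And>i. near 2 (r i) (r (Suc i))"
  obtains g :: "nat \<Rightarrow> 'v"
  where "g 0 = r 0" "\<And>i. near 3 (g i) (g (Suc i))" "inj g" "range g = (\<Union>i. S i)"
proof -
  obtain l where l: "\<And>i. l i \<noteq> [] \<and> set (l i) = S i \<and> distinct (l i) \<and> hd (l i) = r i
     \<and> near 1 (r i) (last (l i)) \<and> successively (near 3) (l i)"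
    using rooted_tree_hamiltonian[OF tree] by metis
  obtain g :: "nat \<Rightarrow> 'v" where g: "g 0 = hd (l 0)" "\<And>i. near 3 (g i) (g (Suc i))"
    "\<And>i j. i < j \<Longrightarrow> g i \<noteq> g j" "range g = (\<Union>n. set (l n))"
  proof (rule infinite_concatenation[of l "near 3" "(\<noteq>)"])
    show "l n \<noteq> []" "successively (near 3) (l n)" for n using l by simp_all
    show "sorted_wrt (\<noteq>) (l n)" for n using l by (simp add: sorted_wrt_iff_nth_less nth_eq_iff_index_eq)
    show "near 3 (last (l n)) (hd (l (Suc n)))" for n
    proof -
      have "near 1 (last (l n)) (r n)" "hd (l (Suc n)) = r (Suc n)" using l near_sym by auto
      then show ?thesis using near_trans[OF _ close[of n], of 1 "last (l n)"] by (simp add: numeral_3_eq_3)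
    qed
    show "x \<noteq> y" if "m < n" "x \<in> set (l m)" "y \<in> set (l n)" for m n x y
      using disj[of m n] l that by auto
  qed blast
  have "inj g" using g(3) by (metis injI linorder_neqE_nat)
  then show thesis using that[of g] g l by simp
qed

lemma line_from_two_rays:
  fixes g h :: "nat \<Rightarrow> 'v"
  assumes g: "\<And>i. near n (g i) (g (Suc i))" "inj g" and h: "\<And>i. near n (h i) (h (Suc i))" "inj h"
    and join: "near n (g 0) (h 0)" and disj: "range g \<inter> range h = {}"
  obtains f :: "int \<Rightarrow> 'v"
  where "bij_betw f UNIV (range g \<union> range h)" "\<And>i. near n (f i) (f (i + 1))"
proof -
  \<comment> \<open>The ray \<open>h\<close> runs backwards through the negative indices, with \<open>h 0\<close> at index \<open>- 1\<close>.\<close>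
  define f where "f i = (if i \<ge> 0 then g (nat i) else h (nat (- i - 1)))" for i :: int
  have "inj f"
  proof (rule injI)
    fix i j assume eq: "f i = f j"
    have "g x \<noteq> h y" for x y using disj by blast
    then show "i = j" using eq g(2) h(2)
      by (auto simp: f_def inj_eq split: if_splits) metis+
  qed
  moreover have "range f = range g \<union> range h"
  proof
    show "range f \<subseteq> range g \<union> range h" by (auto simp: f_def)
    have "g k = f (int k)" for k by (simp add: f_def)
    moreover have "h k = f (- int k - 1)" for k by (simp add: f_def)
    ultimately show "range g \<union> range h \<subseteq> range f" by (metis Un_least image_subset_iff rangeI)
  qed
  moreover have "near n (f i) (f (i + 1))" for i
  proof -
    consider "i \<ge> 0" | "i = -1" | "i < -1" by linarith
    then show ?thesis
    proof cases
      case 1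
      then have "nat (i + 1) = Suc (nat i)" by simp
      then show ?thesis using 1 g(1) by (simp add: f_def)
    next
      case 2
      then show ?thesis using near_sym[OF join] by (simp add: f_def)
    next
      case 3
      then have "nat (- i - 1) = Suc (nat (- (i + 1) - 1))" by simp
      then show ?thesis using 3 near_sym[OF h(1)] by (simp add: f_def)
    qed
  qed
  ultimately show thesis using that[of f] by (simp add: bij_betw_def)
qed

text \<open>
  A one-ended graph has a single ray of bags, but the path must go to infinity in two
  directions. The bags of even index serve one direction and those of odd index the other.
\<close>

lemma line_if_one_ended:
  assumes "one_ended X"
  obtains f :: "int \<Rightarrow> 'v" where "bij_betw f UNIV X" "\<And>i. near 3 (f i) (f (i + 1))"
proof -
  obtain a where a: "a \<in> X" using assms unfolding one_ended_def by (metis ex_in_conv finite.emptyI)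
  obtain r S where r: "\<And>i. E (r i) (r (Suc i))" and S: "\<And>i. rooted_tree (S i) (r i)"
    and disj: "\<And>i j. i \<noteq> j \<Longrightarrow> S i \<inter> S j = {}" and un: "(\<Union>i. S i) = X"
    using one_ended_bagged_ray[OF assms a] by metis
  have two: "near 2 (r i) (r (Suc (Suc i)))" for i
    using near_trans[OF near_adj[OF r] near_adj[OF r], of i] by (simp add: numeral_2_eq_2)
  obtain g :: "nat \<Rightarrow> 'v" where g: "g 0 = r 0" "\<And>i. near 3 (g i) (g (Suc i))" "inj g" "range g = (\<Union>i. S (2 * i))"
    using ray_from_bags[of "\<lambda>i. S (2 * i)" "\<lambda>i. r (2 * i)"] S disj two by auto
  obtain h :: "nat \<Rightarrow> 'v" where h: "h 0 = r 1" "\<And>i. near 3 (h i) (h (Suc i))" "inj h" "range h = (\<Union>i. S (2 * i + 1))"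
    using ray_from_bags[of "\<lambda>i. S (2 * i + 1)" "\<lambda>i. r (2 * i + 1)"] S disj two by auto
  have "near 3 (r 0) (r 1)"
    using near_le[OF near_adj[OF r[of 0]], of 3] by simp
  moreover have "range g \<inter> range h = {}"
  proof -
    have "S (2 * i) \<inter> S (2 * j + 1) = {}" for i j by (rule disj) presburger
    then show ?thesis unfolding g h by blast
  qed
  moreover have "range g \<union> range h = X"
  proof -
    have "S i \<subseteq> range g \<union> range h" for i
      unfolding g h by (cases "even i") (auto elim!: evenE oddE)
    then show ?thesis using un unfolding g h by blast
  qed
  ultimately show thesis
    using line_from_two_rays[OF g(2,3) h(2,3)] g(1) h(1) that by metis
qed

lemma line_if_one_ended_halves:
  assumes A: "one_ended A" "a \<in> A" and B: "one_ended B" "b \<in> B" and "A \<inter> B = {}" "E a b"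
  obtains f :: "int \<Rightarrow> 'v" where "bij_betw f UNIV (A \<union> B)" "\<And>i. near 3 (f i) (f (i + 1))"
proof -
  have half: "\<exists>g::nat \<Rightarrow> 'v. g 0 = x \<and> (\<forall>i. near 3 (g i) (g (Suc i))) \<and> inj g \<and> range g = X"
    if X: "one_ended X" "x \<in> X" for X x
  proof -
    obtain r S where r: "r 0 = x" "\<And>i. E (r i) (r (Suc i))" and S: "\<And>i. rooted_tree (S i) (r i)"
      and disj: "\<And>i j. i \<noteq> j \<Longrightarrow> S i \<inter> S j = {}" and un: "(\<Union>i. S i) = X"
      using one_ended_bagged_ray[OF X] by metis
    have "near 2 (r i) (r (Suc i))" for i
      using near_le[OF near_adj[OF r(2)[of i]], of 2] by simp
    from ray_from_bags[of S r, OF S disj this] show ?thesis using r(1) un by metis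
  qed
  obtain g h :: "nat \<Rightarrow> 'v" where g: "g 0 = a" "\<And>i. near 3 (g i) (g (Suc i))" "inj g" "range g = A"
    and h: "h 0 = b" "\<And>i. near 3 (h i) (h (Suc i))" "inj h" "range h = B"
    using half[OF A] half[OF B] by metis
  have "near 3 a b"
    using near_le[OF near_adj[OF \<open>E a b\<close>], of 3] by simp
  then show thesis using line_from_two_rays[OF g(2,3) h(2,3)] g h assms(5) that by metis
qed

section \<open>Graphs with at most two ends\<close>

text \<open>
  Every component of \<open>V - A\<close> other than that of \<open>b\<close> is joined to the connected set \<open>A\<close> by an edge,
  so these components and \<open>A\<close> together are connected.
\<close>

lemma conn_complement_of_class:
  assumes V: "conn V" and A: "conn A" "A \<subseteq> V" "A \<noteq> {}" and b: "b \<in> V - A"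
  shows "conn (V - {v. reach (V - A) b v})"
proof -
  let ?B = "{v. reach (V - A) b v}"
  obtain c where c: "c \<in> A" using A by blast
  have B: "?B \<subseteq> V - A" using reach_within b by blast
  have AB: "A \<subseteq> V - ?B" using A B by blast
  show ?thesis
  proof (rule conn_if_reach_common)
    fix v assume v: "v \<in> V - ?B"
    have inA: "reach (V - ?B) x c" if "x \<in> A" for x
      using that c A(1) reach_mono[OF AB] by (auto simp: conn_def)
    show "reach (V - ?B) v c"
    proof (cases "v \<in> A")
      case False
      have "reach V v c" using V v c A by (auto simp: conn_def)
      then obtain w k where w: "k \<in> A" "E k w" "w \<in> V - A" "reach (V - A) v w"
        using reach_to_boundary[of V v c A] v False c by (metis Diff_iff)
      have "{z. reach (V - A) v z} \<subseteq> V - ?B"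
      proof
        fix z assume "z \<in> {z. reach (V - A) v z}"
        then have z: "reach (V - A) v z" by simp
        then have "z \<in> V" using v reach_within by blast
        moreover have "\<not> reach (V - A) b z"
          using reach_trans[OF _ reach_sym[OF z]] v by auto
        ultimately show "z \<in> V - ?B" by simp
      qed
      then have "reach (V - ?B) v w" "w \<in> V - ?B" using reach_subset_class w(4) by blast+
      moreover have "reach (V - ?B) w k"
        using reach_edge[OF sym[OF w(2)] \<open>w \<in> V - ?B\<close>] w(1) AB by blast
      ultimately show ?thesis using inA[OF w(1)] reach_trans by metis
    qed (rule inA)
  qed
qed

text \<open>
  If deleting a finite set \<open>F\<close> left two infinite components in \<open>A\<close>, then also deleting the boundary
  of \<open>A\<close> would leave two infinite components in \<open>A\<close> that are separated from the infinite
  connected set \<open>B\<close>. That makes three.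
\<close>

lemma one_ended_part_of_cut:
  assumes V: "at_most_two_ended V" and AB: "A \<inter> B = {}" "A \<union> B = V"
    and A: "infinite A" "conn A" and B: "infinite B" "conn B"
    and bd: "finite {x \<in> A. \<exists>y\<in>B. E x y}"
  shows "one_ended A"
  unfolding one_ended_def
proof (intro conjI allI impI A)
  fix F u v assume F: "finite F" and uv: "infinite_comp (A - F) u" "infinite_comp (A - F) v"
  define D where "D = {x \<in> A. \<exists>y\<in>B. E x y}"
  have fin: "finite D" unfolding D_def by (rule bd)
  define K where "K = (F \<inter> A) \<union> D"
  have K: "finite K" using F fin by (simp add: K_def)
  obtain u' where u': "reach (A - F) u u'" "infinite_comp (A - F - D) u'"
    using infinite_comp_remove_finite[OF uv(1) fin] .
  obtain v' where v': "reach (A - F) v v'" "infinite_comp (A - F - D) v'"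
    using infinite_comp_remove_finite[OF uv(2) fin] .
  have AF: "A - F - D = A - K" by (auto simp: K_def)
  have AK: "A - K \<subseteq> V - K" and BK: "B \<subseteq> V - K" using AB by (auto simp: K_def D_def)
  obtain b where b: "b \<in> B" using B(1) by (metis ex_in_conv finite.emptyI)
  have "B \<subseteq> {w. reach B b w}" using B(2) b by (auto simp: conn_def)
  then have "infinite_comp B b" using B(1) infinite_super by (auto simp: infinite_comp_def)
  then have "infinite_comp (V - K) b" using infinite_comp_mono[OF BK] by simp
  moreover have infs: "infinite_comp (V - K) u'" "infinite_comp (V - K) v'"
    using u'(2) v'(2) infinite_comp_mono[OF AK] unfolding AF by simp_all
  moreover have stay: "reach (A - K) x y" if "reach (V - K) x y" "x \<in> A - K" for x y
  proof -
    have "{w. reach (V - K) x w} \<subseteq> A - K"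
    proof clarify
      fix w assume "reach (V - K) x w"
      then show "w \<in> A - K"
        by (rule reach_closed[OF _ that(2)]) (use AB in \<open>auto simp: K_def D_def\<close>)
    qed
    then show ?thesis using reach_subset_class that(1) by metis
  qed
  moreover have mem: "u' \<in> A - K" "v' \<in> A - K"
    using infinite_comp_mem[OF u'(2)] infinite_comp_mem[OF v'(2)] unfolding AF by simp_all
  moreover have "\<not> reach (V - K) u' b" "\<not> reach (V - K) v' b"
    using stay mem reach_within b AB by blast+
  ultimately have "reach (V - K) u' v'"
    using V K unfolding at_most_two_ended_def by blast
  then have "reach (A - K) u' v'" using stay mem by simp
  then have "reach (A - F) u' v'" using reach_mono[of "A - K" "A - F"] by (auto simp: K_def)
  then show "reach (A - F) u v" using reach_trans u'(1) reach_sym[OF v'(1)] by metis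
qed

text \<open>
  If \<open>V\<close> is not one-ended, some finite \<open>F\<close> separates two infinite components, that of \<open>u\<close> and that
  of \<open>v\<close>. The component \<open>A0\<close> of \<open>u\<close> need not have a connected complement. So \<open>B\<close> is taken as the
  component of \<open>v\<close> in the complement of \<open>A0\<close> and \<open>A\<close> as everything else. Both are connected, and
  all edges between them join \<open>A0\<close> to \<open>F\<close>, so the cut is finite and both halves are one-ended.
\<close>

lemma line_if_at_most_two_ended:
  assumes inf: "infinite V" and V: "conn V" and ends: "at_most_two_ended V"
  obtains f :: "int \<Rightarrow> 'v" where "bij_betw f UNIV V" "\<And>i. near 3 (f i) (f (i + 1))"
proof (cases "one_ended V")
  case True
  then show thesis using line_if_one_ended that by metis
next
  case False
  then obtain F u v where F: "finite F" and u: "infinite_comp (V - F) u" and v: "infinite_comp (V - F) v"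
    and uv: "\<not> reach (V - F) u v"
    using inf V unfolding one_ended_def by blast
  define A0 where "A0 = {w. reach (V - F) u w}"
  have uA: "u \<in> A0" by (simp add: A0_def)
  have A0: "A0 \<subseteq> V - F" using reach_within infinite_comp_mem[OF u] unfolding A0_def by blast
  have infA0: "infinite A0" using u by (simp add: A0_def infinite_comp_def)
  have cA0: "conn A0" unfolding A0_def by (rule reach_conn)
  have out: "y \<in> F" if "x \<in> A0" "E x y" "y \<in> V - A0" for x y
  proof (rule ccontr)
    assume "y \<notin> F"
    then have "reach (V - F) x y" using that A0 by (intro reach_edge) auto
    then show False using that reach_trans unfolding A0_def by blast
  qed
  have vV: "v \<in> V - A0" using infinite_comp_mem[OF v] uv by (simp add: A0_def)
  define B where "B = {w. reach (V - A0) v w}"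
  define A where "A = V - B"
  have BA0: "B \<subseteq> V - A0" using reach_within vV unfolding B_def by blast
  have cB: "conn B" unfolding B_def by (rule reach_conn)
  have cA: "conn A" unfolding A_def B_def
    using conn_complement_of_class[OF V cA0 _ _ vV] A0 uA by blast
  have "A0 \<subseteq> A" using BA0 A0 by (auto simp: A_def)
  then have infA: "infinite A" using infA0 infinite_super by blast
  have infB: "infinite B"
  proof -
    have "{w. reach (V - F) v w} \<subseteq> V - A0"
    proof clarify
      fix w assume w: "reach (V - F) v w"
      then have "w \<in> V" using reach_within vV by blast
      moreover have "w \<notin> A0" using reach_trans[OF _ reach_sym[OF w]] uv by (auto simp: A0_def)
      ultimately show "w \<in> V - A0" by simp
    qed
    then have "{w. reach (V - F) v w} \<subseteq> B"
      using reach_subset_class unfolding B_def by blast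
    then show ?thesis using v infinite_super unfolding infinite_comp_def by blast
  qed
  have AB: "A \<inter> B = {}" "A \<union> B = V" using BA0 by (auto simp: A_def)
  have edge: "x \<in> A0 \<and> y \<in> F" if "x \<in> A" "y \<in> B" "E x y" for x y
  proof -
    have "x \<in> A0"
    proof (rule ccontr)
      assume "x \<notin> A0"
      then have "reach (V - A0) y x" using that BA0 sym by (intro reach_edge) (auto simp: A_def)
      then have "x \<in> B" using that(2) reach_trans unfolding B_def by blast
      then show False using that(1) by (simp add: A_def)
    qed
    then show ?thesis using out that BA0 by blast
  qed
  have bdB: "finite {y \<in> B. \<exists>x\<in>A. E y x}"
    by (rule finite_subset[OF _ F]) (use edge sym in blast)
  have bdA: "finite {x \<in> A. \<exists>y\<in>B. E x y}"
    by (rule finite_subset[OF _ finite_fringe[OF F]]) (use edge in \<open>auto simp: fringe_def intro: sym\<close>)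
  have oA: "one_ended A" by (rule one_ended_part_of_cut[OF ends AB infA cA infB cB bdA])
  have oB: "one_ended B"
    by (rule one_ended_part_of_cut[OF ends _ _ infB cB infA cA bdB]) (use AB in auto)
  have "reach V u v" using V A0 uA vV by (auto simp: conn_def)
  moreover have "u \<in> A" "v \<notin> A" using uA \<open>A0 \<subseteq> A\<close> by (auto simp: A_def B_def)
  ultimately obtain a b where "a \<in> A" "b \<in> V - A" "E a b" using reach_exit by metis
  then have "b \<in> B" by (simp add: A_def)
  then show thesis
    using line_if_one_ended_halves[OF oA \<open>a \<in> A\<close> oB _ AB(1) \<open>E a b\<close>] AB(2) that by metis
qed

section \<open>Bi-infinite paths force at most two ends\<close>

lemma near_reach_avoiding:
  assumes "near n x y" "x \<in> V" and closed: "\<And>x y. x \<in> V \<Longrightarrow> E x y \<Longrightarrow> y \<in> V"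
    and far: "\<And>z. z \<in> F \<Longrightarrow> \<not> near n x z"
  shows "reach (V - F) x y"
proof -
  have "k \<le> n \<Longrightarrow> (E ^^ k) x y \<Longrightarrow> reach (V - F) x y \<and> y \<in> V - F" for k y
  proof (induction k arbitrary: y)
    case 0
    then show ?case using assms(2) far[of x] by auto
  next
    case (Suc k)
    then obtain w where w: "(E ^^ k) x w" "E w y" by auto
    then have ih: "reach (V - F) x w" "w \<in> V - F" using Suc by simp_all
    have "near n x y" using Suc.prems unfolding near_def by blast
    then have "y \<in> V - F" using closed ih(2) w(2) far by blast
    then show ?case using ih w reach_edge reach_trans by metis
  qed
  then show ?thesis using assms(1) unfolding near_def by blast
qed

lemma at_most_two_ended_if_line:
  fixes f :: "int \<Rightarrow> 'v"
  assumes closed: "\<And>x y. x \<in> V \<Longrightarrow> E x y \<Longrightarrow> y \<in> V"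
    and f: "bij_betw f UNIV V" and jump: "\<And>i. near n (f i) (f (i + 1))"
  shows "at_most_two_ended V"
  unfolding at_most_two_ended_def
proof (intro allI impI)
  fix F u v w assume F: "finite F" and infs: "infinite_comp (V - F) u" "infinite_comp (V - F) v" "infinite_comp (V - F) w"
  have injf: "inj f" and ranf: "range f = V" using f by (auto simp: bij_betw_def)
  \<comment> \<open>The indices from which a jump might meet \<open>F\<close>.\<close>
  define I where "I = f -` (\<Union>z\<in>F. {x. near n z x})"
  have "finite I" unfolding I_def using F finite_near injf by (intro finite_vimageI) auto
  define m where "m = Max (insert 0 (abs ` I))"
  have m: "\<bar>i\<bar> \<le> m" if "i \<in> I" for i
    unfolding m_def using \<open>finite I\<close> that by (intro Max_ge) auto
  have m0: "0 \<le> m" unfolding m_def using \<open>finite I\<close> by (intro Max_ge) auto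
  have hop: "reach (V - F) (f i) (f (i + 1))" if "m < \<bar>i\<bar>" for i
  proof (rule near_reach_avoiding[OF jump _ closed])
    show "f i \<in> V" using ranf by blast
    show "\<not> near n (f i) z" if "z \<in> F" for z
    proof
      assume "near n (f i) z"
      then have "i \<in> I" using near_sym that by (auto simp: I_def)
      then show False using m \<open>m < \<bar>i\<bar>\<close> by force
    qed
  qed
  have right: "reach (V - F) (f (m + 1)) (f i)" if "m + 1 \<le> i" for i
    using that
  proof (induction rule: int_ge_induct)
    case (step i)
    then have "reach (V - F) (f i) (f (i + 1))" using m0 by (intro hop) simp
    then show ?case using step.IH reach_trans by metis
  qed simp
  have left: "reach (V - F) (f (- m - 1)) (f i)" if "i \<le> - m - 1" for i
    using that
  proof (induction rule: int_le_induct)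
    case (step i)
    then have "reach (V - F) (f (i - 1)) (f (i - 1 + 1))" using m0 by (intro hop) simp
    then show ?case using step.IH reach_trans reach_sym by (metis diff_add_cancel)
  qed simp
  \<comment> \<open>An infinite component meets the path outside the finite stretch of indices from \<open>- m\<close> to \<open>m\<close>.\<close>
  have tail: "reach (V - F) x (f (m + 1)) \<or> reach (V - F) x (f (- m - 1))"
    if x: "infinite_comp (V - F) x" for x
  proof -
    have "infinite ({y. reach (V - F) x y} - f ` {- m..m})"
      using x by (simp add: infinite_comp_def)
    then obtain y where y: "reach (V - F) x y" "y \<notin> f ` {- m..m}"
      by (metis (mono_tags, lifting) DiffE ex_in_conv finite.emptyI mem_Collect_eq)
    have "y \<in> V" using y(1) reach_within infinite_comp_mem[OF x] by blast
    then obtain i where i: "y = f i" using ranf by blast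
    then have "i \<notin> {- m..m}" using y(2) by blast
    then consider "m + 1 \<le> i" | "i \<le> - m - 1" by force
    then show ?thesis
    proof cases
      case 1
      then show ?thesis using reach_trans[OF y(1)] reach_sym[OF right] i by blast
    next
      case 2
      then show ?thesis using reach_trans[OF y(1)] reach_sym[OF left] i by blast
    qed
  qed
  have "reach (V - F) x y" if "reach (V - F) x z" "reach (V - F) y z" for x y z
    using reach_trans[OF that(1) reach_sym[OF that(2)]] .
  then show "reach (V - F) u v \<or> reach (V - F) u w \<or> reach (V - F) v w"
    using tail[OF infs(1)] tail[OF infs(2)] tail[OF infs(3)] by metis
qed

end

section \<open>Multigraphs as adjacency relations\<close>

definition adjacent :: "('v, 'e) multigraph \<Rightarrow> 'v \<Rightarrow> 'v \<Rightarrow> bool" where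
  "adjacent G u v \<longleftrightarrow> (\<exists>e\<in>edges G. endpoints G e = Upair u v)"

lemma adjacent_verts: "wf_multigraph G \<Longrightarrow> adjacent G u v \<Longrightarrow> u \<in> verts G \<and> v \<in> verts G"
  by (force simp: adjacent_def wf_multigraph_def)

lemma walk_iff_relpowp:
  assumes wf: "wf_multigraph G" and u: "u \<in> verts G"
  shows "(\<exists>es. length es = n \<and> walk G u es v) \<longleftrightarrow> (adjacent G ^^ n) u v"
  using u
proof (induction n arbitrary: u)
  case (Suc n)
  have "(\<exists>es. length es = Suc n \<and> walk G u es v)
      \<longleftrightarrow> (\<exists>w. adjacent G u w \<and> (\<exists>es. length es = n \<and> walk G w es v))"
    by (fastforce simp: length_Suc_conv adjacent_def)
  also have "\<dots> \<longleftrightarrow> (\<exists>w. adjacent G u w \<and> (adjacent G ^^ n) w v)"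
    using Suc.IH adjacent_verts[OF wf] by blast
  also have "\<dots> \<longleftrightarrow> (adjacent G ^^ Suc n) u v"
    by (metis relpowp_Suc_D2 relpowp_Suc_I2)
  finally show ?case .
qed auto

lemma walk_iff_rtranclp:
  assumes "wf_multigraph G" "u \<in> verts G"
  shows "(\<exists>es. walk G u es v) \<longleftrightarrow> (adjacent G)\<^sup>*\<^sup>* u v"
  unfolding rtranclp_power using walk_iff_relpowp[OF assms] by metis

lemma locally_finite_adjacency_adjacent:
  assumes wf: "wf_multigraph G" and lf: "locally_finite_multigraph G"
  shows "locally_finite_adjacency (adjacent G)"
proof
  show "adjacent G y x" if "adjacent G x y" for x y
    using that by (metis adjacent_def Upair_inject)
  show "finite {y. adjacent G x y}" for x
  proof (cases "x \<in> verts G")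
    case True
    let ?I = "{e \<in> edges G. x \<in> set_uprod (endpoints G e)}"
    have "finite ?I" using lf True by (simp add: locally_finite_multigraph_def)
    then have "finite (\<Union>e\<in>?I. set_uprod (endpoints G e))"
      by (simp add: finite_set_uprod)
    moreover have "{y. adjacent G x y} \<subseteq> (\<Union>e\<in>?I. set_uprod (endpoints G e))"
      by (force simp: adjacent_def)
    ultimately show ?thesis by (rule rev_finite_subset)
  next
    case False
    then have "{y. adjacent G x y} = {}" using adjacent_verts[OF wf] by blast
    then show ?thesis by simp
  qed
qed

lemma wf_delete_verts: "wf_multigraph G \<Longrightarrow> wf_multigraph (delete_verts G F)"
  by (fastforce simp: wf_multigraph_def delete_verts_def)

lemma adjacent_delete_verts:
  assumes "wf_multigraph G"
  shows "adjacent (delete_verts G F) u v \<longleftrightarrow> adjacent G u v \<and> u \<in> verts G - F \<and> v \<in> verts G - F"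
proof
  assume "adjacent (delete_verts G F) u v"
  then show "adjacent G u v \<and> u \<in> verts G - F \<and> v \<in> verts G - F"
    using adjacent_verts[OF wf_delete_verts[OF assms], of F u v]
    by (auto simp: adjacent_def delete_verts_def)
next
  assume "adjacent G u v \<and> u \<in> verts G - F \<and> v \<in> verts G - F"
  then show "adjacent (delete_verts G F) u v" by (auto simp: adjacent_def delete_verts_def)
qed

lemma finite_union_edges:
  assumes lf: "locally_finite_multigraph G" and W: "finite W" "W \<subseteq> verts G"
  shows "finite {e \<in> edges G. set_uprod (endpoints G e) \<inter> W \<noteq> {}}"
proof -
  have "{e \<in> edges G. set_uprod (endpoints G e) \<inter> W \<noteq> {}}
      = (\<Union>v\<in>W. {e \<in> edges G. v \<in> set_uprod (endpoints G e)})" by auto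
  then show ?thesis using assms by (auto simp: locally_finite_multigraph_def)
qed

lemma set_uprod_nonempty: "set_uprod p \<noteq> {}"
  by (cases p) auto

locale locally_finite_wf_multigraph =
  fixes G :: "('v, 'e) multigraph"
  assumes wf: "wf_multigraph G" and lf: "locally_finite_multigraph G"
begin

sublocale locally_finite_adjacency "adjacent G"
  by (rule locally_finite_adjacency_adjacent[OF wf lf])

lemma walk_delete_iff_reach:
  assumes "u \<in> verts G - F"
  shows "(\<exists>es. walk (delete_verts G F) u es w) \<longleftrightarrow> reach (verts G - F) u w"
proof -
  have "u \<in> verts (delete_verts G F)" using assms by (simp add: delete_verts_def)
  moreover have "adjacent (delete_verts G F)
      = (\<lambda>x y. adjacent G x y \<and> x \<in> verts G - F \<and> y \<in> verts G - F)"
    by (intro ext adjacent_delete_verts[OF wf])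
  ultimately show ?thesis
    using walk_iff_rtranclp[OF wf_delete_verts[OF wf]] by (simp add: reach_def)
qed

text \<open>
  A component with finitely many vertices has finitely many edges by local finiteness. Conversely,
  every vertex of the component except possibly \<open>u\<close> is an endpoint of one of its edges, so
  finitely many edges leave finitely many vertices.
\<close>

lemma finite_component_iff:
  assumes u: "u \<in> verts G - F"
  shows "finite_multigraph (component_of (delete_verts G F) u) \<longleftrightarrow> \<not> infinite_comp (verts G - F) u"
proof -
  let ?W = "{w. reach (verts G - F) u w}"
  let ?D = "{e \<in> edges G. set_uprod (endpoints G e) \<inter> F = {} \<and> set_uprod (endpoints G e) \<subseteq> ?W}"
  have WV: "?W \<subseteq> verts G - F" using u reach_within by blast
  have eq: "edges (component_of (delete_verts G F) u) = ?D"
    unfolding component_of_def walk_delete_iff_reach[OF u] Let_def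
    by (auto simp: delete_verts_def)
  have "finite ?D" if "finite ?W"
  proof (rule finite_subset[OF _ finite_union_edges[OF lf that]])
    show "?W \<subseteq> verts G" using WV by blast
    show "?D \<subseteq> {e \<in> edges G. set_uprod (endpoints G e) \<inter> ?W \<noteq> {}}"
    proof clarify
      fix e assume "set_uprod (endpoints G e) \<subseteq> ?W" "set_uprod (endpoints G e) \<inter> ?W = {}"
      then show False using set_uprod_nonempty[of "endpoints G e"] by blast
    qed
  qed
  moreover have "finite ?W" if "finite ?D"
  proof -
    have "?W \<subseteq> insert u (\<Union>e\<in>?D. set_uprod (endpoints G e))"
    proof clarify
      fix w assume w: "reach (verts G - F) u w" "w \<notin> (\<Union>e\<in>?D. set_uprod (endpoints G e))"
      from w show "w = u"
      proof (induction rule: reach_induct)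
        case (step x y)
        then obtain e where e: "e \<in> edges G" "endpoints G e = Upair x y" by (auto simp: adjacent_def)
        have "reach (verts G - F) u y" using reach_trans reach_edge step.hyps by metis
        then have "e \<in> ?D" using e step.hyps by auto
        then have "y \<in> (\<Union>e\<in>?D. set_uprod (endpoints G e))" using e by force
        then show ?case using step.prems by blast
      qed simp
    qed
    moreover have "finite (insert u (\<Union>e\<in>?D. set_uprod (endpoints G e)))"
      using that by (simp add: finite_set_uprod)
    ultimately show ?thesis by (rule finite_subset)
  qed
  ultimately show ?thesis unfolding finite_multigraph_def eq infinite_comp_def by blast
qed

definition infinite_components :: "'v set \<Rightarrow> ('v, 'e) multigraph set" where
  "infinite_components F =
     {C \<in> components_multigraph (delete_verts G F). \<not> finite_multigraph C}"

lemma infinite_components_eq: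
  "infinite_components F = component_of (delete_verts G F) ` {u. infinite_comp (verts G - F) u}"
proof -
  have "verts (delete_verts G F) = verts G - F" by (simp add: delete_verts_def)
  then show ?thesis
    unfolding infinite_components_def components_multigraph_def
    using finite_component_iff infinite_comp_mem by blast
qed

lemma component_of_eq_iff:
  assumes "u \<in> verts G - F" "v \<in> verts G - F"
  shows "component_of (delete_verts G F) u = component_of (delete_verts G F) v
     \<longleftrightarrow> reach (verts G - F) u v"
proof
  assume "component_of (delete_verts G F) u = component_of (delete_verts G F) v"
  then have "verts (component_of (delete_verts G F) u) = verts (component_of (delete_verts G F) v)"
    by simp
  then have "{w. reach (verts G - F) u w} = {w. reach (verts G - F) v w}"
    by (simp add: component_of_def Let_def walk_delete_iff_reach[OF assms(1)]
        walk_delete_iff_reach[OF assms(2)])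
  then have "v \<in> {w. reach (verts G - F) u w}" by simp
  then show "reach (verts G - F) u v" by simp
next
  assume "reach (verts G - F) u v"
  from reach_class_eq[OF this]
  show "component_of (delete_verts G F) u = component_of (delete_verts G F) v"
    by (simp add: component_of_def walk_delete_iff_reach[OF assms(1)]
        walk_delete_iff_reach[OF assms(2)])
qed

end

lemma ecard_le_two_iff:
  "ecard A \<le> 2 \<longleftrightarrow> (\<forall>x\<in>A. \<forall>y\<in>A. \<forall>z\<in>A. x = y \<or> x = z \<or> y = z)"
proof
  assume A: "ecard A \<le> 2"
  then have fin: "finite A" by (auto simp: ecard_def split: if_splits)
  then have card: "card A \<le> 2" using A by (simp add: ecard_def numeral_eq_enat)
  show "\<forall>x\<in>A. \<forall>y\<in>A. \<forall>z\<in>A. x = y \<or> x = z \<or> y = z"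
  proof (intro ballI, rule ccontr)
    fix x y z assume "x \<in> A" "y \<in> A" "z \<in> A" "\<not> (x = y \<or> x = z \<or> y = z)"
    then have "card {x, y, z} = 3" "{x, y, z} \<subseteq> A" by auto
    then have "3 \<le> card A" using card_mono[OF fin] by metis
    then show False using card by simp
  qed
next
  assume A: "\<forall>x\<in>A. \<forall>y\<in>A. \<forall>z\<in>A. x = y \<or> x = z \<or> y = z"
  have "\<exists>x y. A \<subseteq> {x, y}"
  proof (cases "\<exists>x\<in>A. \<exists>y\<in>A. x \<noteq> y")
    case True
    then show ?thesis using A by blast
  next
    case False
    then show ?thesis by blast
  qed
  then obtain x y where xy: "A \<subseteq> {x, y}" by blast
  then have "finite A" by (rule finite_subset) simp
  moreover have "card A \<le> 2"
    using card_mono[OF _ xy] card_insert_le_m1[of 2 "{y}" x] by simp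
  ultimately show "ecard A \<le> 2" by (simp add: ecard_def numeral_eq_enat)
qed

context locally_finite_wf_multigraph begin

lemma num_ends_le_two_iff: "num_ends G \<le> 2 \<longleftrightarrow> at_most_two_ended (verts G)"
proof -
  define P where "P Z \<longleftrightarrow> (\<forall>u v w. infinite_comp Z u \<longrightarrow> infinite_comp Z v \<longrightarrow> infinite_comp Z w \<longrightarrow>
      reach Z u v \<or> reach Z u w \<or> reach Z v w)" for Z
  have two: "ecard (infinite_components F) \<le> 2 \<longleftrightarrow> P (verts G - F)" for F
  proof -
    have "component_of (delete_verts G F) u = component_of (delete_verts G F) v
        \<longleftrightarrow> reach (verts G - F) u v"
      if "infinite_comp (verts G - F) u" "infinite_comp (verts G - F) v" for u v
      using component_of_eq_iff[OF infinite_comp_mem infinite_comp_mem] that by simp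
    then show ?thesis
      unfolding ecard_le_two_iff infinite_components_eq P_def by (simp add: ball_simps) blast
  qed
  have "num_ends G \<le> 2 \<longleftrightarrow> (\<forall>F. finite F \<and> F \<subseteq> verts G \<longrightarrow> ecard (infinite_components F) \<le> 2)"
    unfolding num_ends_def infinite_components_def by (simp add: SUP_le_iff)
  also have "\<dots> \<longleftrightarrow> (\<forall>F. finite F \<longrightarrow> P (verts G - F))"
  proof
    assume P: "\<forall>F. finite F \<and> F \<subseteq> verts G \<longrightarrow> ecard (infinite_components F) \<le> 2"
    \<comment> \<open>The number of ends only considers sets \<open>F\<close> of vertices; other sets reduce to their intersection with the vertex set.\<close>
    show "\<forall>F. finite F \<longrightarrow> P (verts G - F)"
    proof (intro allI impI)
      fix F :: "'v set" assume "finite F"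
      then have "P (verts G - F \<inter> verts G)" using P two by simp
      moreover have "verts G - F \<inter> verts G = verts G - F" by blast
      ultimately show "P (verts G - F)" by simp
    qed
  qed (simp add: two)
  also have "\<dots> \<longleftrightarrow> at_most_two_ended (verts G)"
    unfolding at_most_two_ended_def P_def by blast
  finally show ?thesis .
qed

lemma reach_verts_iff_walk: "u \<in> verts G \<Longrightarrow> reach (verts G) u w \<longleftrightarrow> (\<exists>es. walk G u es w)"
proof -
  assume u: "u \<in> verts G"
  have "(\<lambda>x y. adjacent G x y \<and> x \<in> verts G \<and> y \<in> verts G) = adjacent G"
    using adjacent_verts[OF wf] by blast
  then show ?thesis using walk_iff_rtranclp[OF wf u] by (simp add: reach_def)
qed

lemma conn_verts: "connected_multigraph G \<Longrightarrow> conn (verts G)"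
  using reach_verts_iff_walk by (auto simp: conn_def connected_multigraph_def)

lemma infinite_verts: "\<not> finite_multigraph G \<Longrightarrow> infinite (verts G)"
proof
  assume "\<not> finite_multigraph G" "finite (verts G)"
  moreover have "set_uprod (endpoints G e) \<inter> verts G \<noteq> {}" if "e \<in> edges G" for e
    using wf set_uprod_nonempty[of "endpoints G e"] that by (simp add: wf_multigraph_def inf_absorb1)
  then have "edges G = {e \<in> edges G. set_uprod (endpoints G e) \<inter> verts G \<noteq> {}}" by auto
  ultimately show False
    using finite_union_edges[OF lf _ order_refl] unfolding finite_multigraph_def by simp
qed

lemma num_ends_ge_one:
  assumes "\<not> finite_multigraph G" "connected_multigraph G"
  shows "1 \<le> num_ends G"
proof -
  obtain u where u: "u \<in> verts G" using assms(2) by (auto simp: connected_multigraph_def)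
  have "verts G \<subseteq> {w. reach (verts G) u w}" using conn_verts[OF assms(2)] u by (auto simp: conn_def)
  then have "infinite_comp (verts G - {}) u"
    using infinite_verts[OF assms(1)] infinite_super by (auto simp: infinite_comp_def)
  then have "infinite_components {} \<noteq> {}" unfolding infinite_components_eq by blast
  then have "1 \<le> ecard (infinite_components {})"
    by (auto simp: ecard_def one_enat_def Suc_le_eq card_gt_0_iff)
  also have "\<dots> \<le> num_ends G"
    unfolding num_ends_def infinite_components_def by (rule SUP_upper) simp
  finally show ?thesis .
qed

lemma near_iff_path_dist:
  assumes conn: "connected_multigraph G" and uv: "u \<in> verts G" "v \<in> verts G"
  shows "near n u v \<longleftrightarrow> path_dist G u v \<le> real n"
proof
  assume "near n u v"
  then obtain k es where "k \<le> n" "length es = k" "walk G u es v"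
    unfolding near_def using walk_iff_relpowp[OF wf uv(1)] by metis
  then show "path_dist G u v \<le> real n" using path_dist_le by fastforce
next
  assume d: "path_dist G u v \<le> real n"
  obtain es where "walk G u es v" using conn uv by (auto simp: connected_multigraph_def)
  then obtain fs where "walk G u fs v" "path_dist G u v = real (length fs)"
    using path_dist_attained by metis
  then show "near n u v"
    unfolding near_def using d walk_iff_relpowp[OF wf uv(1), of "length fs" v] by auto
qed

end

section \<open>Transitive actions of the integers as bi-infinite paths\<close>

text \<open>
  The path is the orbit of any vertex: freeness makes it injective, transitivity makes it
  surjective, and the displacement of the generator 1 bounds its jumps.
\<close>

lemma line_of_action:
  assumes "transitive_translation_like_on_graph integer_group G act"
  obtains f :: "int \<Rightarrow> 'v" and n :: nat
  where "bij_betw f UNIV (verts G)" "\<And>i. path_dist G (f i) (f (i + 1)) \<le> real n"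
proof -
  interpret translation_like_action integer_group "verts G" "path_dist G" act
    using assms by (simp add: transitive_translation_like_on_graph_def)
  have "is_singleton ((\<lambda>x. range (act x)) ` verts G)"
    using assms by (simp add: transitive_translation_like_on_graph_def transitive_action_def)
  then obtain Q where Q: "(\<lambda>x. range (act x)) ` verts G = {Q}" by (auto simp: is_singleton_def)
  then have "verts G \<noteq> {}" by (metis image_empty insert_not_empty)
  then obtain x where x: "x \<in> verts G" by auto
  have one: "act y 0 = y" if "y \<in> verts G" for y using act_one[OF that] by simp
  have mult: "act y (i + j) = act (act y i) j" if "y \<in> verts G" for y i j
    using act_mult[OF that, of i j] by simp
  have closed: "act y i \<in> verts G" if "y \<in> verts G" for y i using act_closed[OF that] by simp
  have "inj (act x)"
  proof (rule injI)
    fix i j assume eq: "act x i = act x j"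
    have "act (act x i) (j - i) = act x i" using mult[OF x, of i "j - i"] eq by simp
    then have "j - i = 0" using free[of "act x i" "j - i"] closed[OF x] by simp
    then show "i = j" by simp
  qed
  moreover have "range (act x) = verts G"
  proof
    show "range (act x) \<subseteq> verts G" using closed[OF x] by blast
    show "verts G \<subseteq> range (act x)"
    proof
      fix y assume y: "y \<in> verts G"
      have "range (act x) = Q" "range (act y) = Q" using Q x y by blast+
      then show "y \<in> range (act x)" using one[OF y] by (metis rangeI)
    qed
  qed
  ultimately have "bij_betw (act x) UNIV (verts G)" by (simp add: bij_betw_def)
  moreover obtain b where b: "\<And>y. y \<in> verts G \<Longrightarrow> path_dist G y (act y 1) \<le> b"
  proof -
    have "bounded {path_dist G y (act y 1) | y. y \<in> verts G}"
      using bounded_displacement[of 1] by simp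
    then obtain b where "\<And>r. r \<in> {path_dist G y (act y 1) | y. y \<in> verts G} \<Longrightarrow> \<bar>r\<bar> \<le> b"
      by (auto simp: bounded_iff)
    then show thesis using that[of b] by (metis (mono_tags, lifting) abs_le_D1 mem_Collect_eq)
  qed
  obtain n :: nat where "b \<le> real n" using real_arch_simple by blast
  then have "path_dist G (act x i) (act x (i + 1)) \<le> real n" for i
    using b[OF closed[OF x, of i]] mult[OF x, of i 1] by simp
  ultimately show thesis using that by blast
qed

text \<open>
  The integer \<open>k\<close> shifts the path by \<open>k\<close> places. The triangle inequality bounds its displacement
  by \<open>\<bar>k\<bar>\<close> jumps.
\<close>

lemma action_of_line:
  fixes f :: "int \<Rightarrow> 'v"
  assumes wf: "wf_multigraph G" and conn: "connected_multigraph G"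
    and f: "bij_betw f UNIV (verts G)" and jump: "\<And>i. path_dist G (f i) (f (i + 1)) \<le> c"
  obtains act where "transitive_translation_like_on_graph integer_group G act"
    "\<And>v. v \<in> verts G \<Longrightarrow> path_dist G v (act v 1) \<le> c"
proof -
  define act where "act v k = f (the_inv f v + k)" for v and k :: int
  have inj: "inj f" and ran: "range f = verts G" using f by (auto simp: bij_betw_def)
  have act_f: "act (f i) k = f (i + k)" for i k by (simp add: act_def the_inv_f_f[OF inj])
  have ex: "\<exists>i. v = f i" if "v \<in> verts G" for v using that ran by blast
  have fv: "f i \<in> verts G" for i using ran by blast
  interpret M: Metric_space "verts G" "path_dist G" by (rule Metric_space_path_dist[OF wf conn])
  have far: "path_dist G (f i) (f (i + int k)) \<le> c * real k" for i k
  proof (induction k)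
    case 0
    then show ?case using M.zero[OF fv fv, of i i] by simp
  next
    case (Suc k)
    have "path_dist G (f i) (f (i + int (Suc k)))
        \<le> path_dist G (f i) (f (i + int k)) + path_dist G (f (i + int k)) (f (i + int k + 1))"
    proof -
      have "i + int (Suc k) = i + int k + 1" by simp
      then show ?thesis using M.triangle[OF fv fv fv, of i "i + int k + 1" "i + int k"] by metis
    qed
    then show ?case using Suc jump[of "i + int k"] by (simp add: algebra_simps)
  qed
  have bd: "path_dist G (f i) (f (i + k)) \<le> c * real (nat \<bar>k\<bar>)" for i k
  proof (cases "k \<ge> 0")
    case True
    then show ?thesis using far[of i "nat k"] by simp
  next
    case False
    then show ?thesis
      using far[of "i + k" "nat (- k)"] M.commute[of "f i" "f (i + k)"] by simp
  qed
  have "translation_like_action integer_group (verts G) (path_dist G) act"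
  proof (intro translation_like_action.intro right_action.intro right_action_axioms.intro
      translation_like_action_axioms.intro)
    show "group integer_group" by (rule group_integer_group)
    show "Metric_space (verts G) (path_dist G)" by (rule M.Metric_space_axioms)
  next
    fix x and h :: int assume x: "x \<in> verts G"
    show "act x h \<in> verts G" using fv by (simp add: act_def)
  next
    fix x assume "x \<in> verts G"
    then show "act x \<one>\<^bsub>integer_group\<^esub> = x" using ex act_f by fastforce
  next
    fix x and g h :: int assume "x \<in> verts G"
    then show "act x (g \<otimes>\<^bsub>integer_group\<^esub> h) = act (act x g) h"
      using ex act_f by (fastforce simp: add.assoc)
  next
    fix x and h :: int assume "x \<in> verts G" "act x h = x"
    then obtain i where "f (i + h) = f i" using ex act_f by metis
    then show "h = \<one>\<^bsub>integer_group\<^esub>" using inj by (simp add: inj_eq)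
  next
    fix h :: int
    have "\<bar>path_dist G v (act v h)\<bar> \<le> c * real (nat \<bar>h\<bar>)" if "v \<in> verts G" for v
      using ex[OF that] bd act_f M.nonneg by auto
    then show "bounded {path_dist G x (act x h) |x. x \<in> verts G}"
      unfolding bounded_iff real_norm_def by blast
  qed
  moreover have "transitive_action integer_group (verts G) act"
  proof -
    have "range (act v) = verts G" if v: "v \<in> verts G" for v
    proof -
      obtain i where i: "v = f i" using ex[OF v] by blast
      have "act v = f \<circ> (+) i" by (auto simp: i act_f)
      then have "range (act v) = f ` range ((+) i)" by (simp only: image_comp)
      then show ?thesis using ran by simp
    qed
    then have "(\<lambda>x. range (act x)) ` verts G = (\<lambda>x. verts G) ` verts G"
      by (rule image_cong[OF refl])
    also have "\<dots> = {verts G}" using fv[of 0] by (simp add: image_constant)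
    finally have "(\<lambda>x. range (act x)) ` verts G = {verts G}" .
    then show ?thesis by (simp add: transitive_action_def)
  qed
  moreover have "path_dist G v (act v 1) \<le> c" if "v \<in> verts G" for v
    using ex[OF that] act_f jump by auto
  ultimately show thesis using that unfolding transitive_translation_like_on_graph_def by blast
qed

theorem theorem1p3:
  fixes \<Gamma> :: "('v, 'e) multigraph"
  assumes "wf_multigraph \<Gamma>"
    and "\<not> finite_multigraph \<Gamma>"
    and "connected_multigraph \<Gamma>"
    and "locally_finite_multigraph \<Gamma>"
  shows "((\<exists>act. transitive_translation_like_on_graph integer_group \<Gamma> act)
            \<longleftrightarrow> num_ends \<Gamma> = 1 \<or> num_ends \<Gamma> = 2)
       \<and> (num_ends \<Gamma> = 1 \<or> num_ends \<Gamma> = 2 \<longrightarrow>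
            (\<exists>act. transitive_translation_like_on_graph integer_group \<Gamma> act
              \<and> (\<forall>v\<in>verts \<Gamma>. path_dist \<Gamma> v (act v 1) \<le> 3)))"
proof -
  interpret locally_finite_wf_multigraph \<Gamma> using assms by unfold_locales
  have ends: "num_ends \<Gamma> = 1 \<or> num_ends \<Gamma> = 2 \<longleftrightarrow> at_most_two_ended (verts \<Gamma>)"
  proof -
    have "num_ends \<Gamma> = 1 \<or> num_ends \<Gamma> = 2 \<longleftrightarrow> num_ends \<Gamma> \<le> 2"
      using num_ends_ge_one[OF assms(2,3)]
      by (cases "num_ends \<Gamma>") (auto simp: one_enat_def numeral_eq_enat)
    then show ?thesis using num_ends_le_two_iff by simp
  qed
  have line: "at_most_two_ended (verts \<Gamma>)"
    if "transitive_translation_like_on_graph integer_group \<Gamma> act" for act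
  proof -
    obtain f :: "int \<Rightarrow> 'v" and n where f: "bij_betw f UNIV (verts \<Gamma>)"
      and d: "\<And>i. path_dist \<Gamma> (f i) (f (i + 1)) \<le> real n"
      using line_of_action[OF \<open>transitive_translation_like_on_graph integer_group \<Gamma> act\<close>] by blast
    have "f i \<in> verts \<Gamma>" for i using f by (auto simp: bij_betw_def)
    then have "near n (f i) (f (i + 1))" for i
      using near_iff_path_dist[OF assms(3)] d by blast
    with f show ?thesis
      using at_most_two_ended_if_line adjacent_verts[OF assms(1)] by blast
  qed
  have action: "\<exists>act. transitive_translation_like_on_graph integer_group \<Gamma> act
      \<and> (\<forall>v\<in>verts \<Gamma>. path_dist \<Gamma> v (act v 1) \<le> 3)" if two: "at_most_two_ended (verts \<Gamma>)"
  proof -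
    obtain f :: "int \<Rightarrow> 'v" where f: "bij_betw f UNIV (verts \<Gamma>)"
      and n: "\<And>i. near 3 (f i) (f (i + 1))"
      using line_if_at_most_two_ended[OF infinite_verts[OF assms(2)] conn_verts[OF assms(3)] two] by blast
    have "f i \<in> verts \<Gamma>" for i using f by (auto simp: bij_betw_def)
    then have "path_dist \<Gamma> (f i) (f (i + 1)) \<le> real 3" for i
      using near_iff_path_dist[OF assms(3)] n by blast
    then have "path_dist \<Gamma> (f i) (f (i + 1)) \<le> 3" for i by simp
    from action_of_line[OF assms(1,3) f this] show ?thesis by metis
  qed
  show ?thesis unfolding ends using line action by blast
qed

end
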